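(* There exists no mixed irreducible weight module of $\mathfrak{L}$; that is, there is no irreducible weight module $M$ of $\mathfrak{L}$ for which there exist $\lambda,\mu\in\mathrm{Supp}(M)$ with $\dim M_\lambda=\infty$ and $\dim M_\mu<\infty$.
   Context: $\mathfrak{L}$ (the super $W(2,2)$ algebra) is the Lie superalgebra over $\mathbb{C}$ with basis $\{L_n,I_n,G_n,H_n\mid n\in\mathbb{Z}\}$, even part spanned by the $L_n,I_n$ and odd part spanned by the $G_n,H_n$, and with non-vanishing brackets (for $m,n\in\mathbb{Z}$) $[L_m,L_n]=(m-n)L_{m+n}$, $[L_m,I_n]=(m-n)I_{m+n}$, $[L_m,H_n]=(\frac{m}{2}-n)H_{m+n}$, $[G_m,G_n]=I_{m+n}$, $[L_m,G_n]=(\frac{m}{2}-n)G_{m+n}$, $[I_m,G_n]=(m-2n)H_{m+n}$; brackets of basis elements that do not follow from these by super-antisymmetry are zero. The Cartan subalgebra is $\mathfrak{h}=\mathbb{C}L_0$. A weight module is an $\mathfrak{L}$-module $M=\bigoplus_{\lambda\in\mathbb{C}}M_\lambda$ with $M_\lambda=\{x\in M\mid L_0x=-\lambda x\}$, and $\mathrm{Supp}(M)=\{\lambda\in\mathbb{C}\mid M_\lambda\neq 0\}$. A weight module $M$ is called mixed if there exist $\lambda,\mu\in\mathrm{Supp}(M)$ such that $\dim M_\lambda=\infty$ and $\dim M_\mu<\infty$. *)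

theory Defs
  imports Complex_Main "HOL-Library.Poly_Mapping" "HOL-Library.Z2"
begin

section \<open>Lie superalgebras and their modules over the complex numbers\<close>

text \<open>
  Parities live in the two-element type \<^typ>\<open>bit\<close>, so that addition of parities is addition
  modulo 2.  A super vector space is a vector space carried by a whole type, with a family
  \<open>hom\<close> giving its even part \<open>hom 0\<close> and its odd part \<open>hom 1\<close>.
\<close>

locale super_vector_space =
  vector_space scale for scale :: "complex \<Rightarrow> 'v::ab_group_add \<Rightarrow> 'v" +
  fixes hom :: "bit \<Rightarrow> 'v set"
  assumes subspace_hom: "subspace (hom i)"
    and hom_disjoint: "hom 0 \<inter> hom 1 = {0}"
    and hom_spans: "\<exists>a\<in>hom 0. \<exists>b\<in>hom 1. v = a + b"

definition super_sign :: "bit \<Rightarrow> bit \<Rightarrow> complex" where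
  "super_sign i j = (if i = 1 \<and> j = 1 then - 1 else 1)"

locale lie_superalgebra =
  super_vector_space scale hom
    for scale :: "complex \<Rightarrow> 'g::ab_group_add \<Rightarrow> 'g" and hom :: "bit \<Rightarrow> 'g set" +
  fixes bracket :: "'g \<Rightarrow> 'g \<Rightarrow> 'g"
  assumes linear_bracket_right: "Vector_Spaces.linear scale scale (\<lambda>y. bracket x y)"
    and linear_bracket_left: "Vector_Spaces.linear scale scale (\<lambda>x. bracket x y)"
    and bracket_hom: "x \<in> hom i \<Longrightarrow> y \<in> hom j \<Longrightarrow> bracket x y \<in> hom (i + j)"
    and super_antisym: "x \<in> hom i \<Longrightarrow> y \<in> hom j \<Longrightarrow>
      bracket x y = - scale (super_sign i j) (bracket y x)"
    and super_jacobi: "x \<in> hom i \<Longrightarrow> y \<in> hom j \<Longrightarrow> z \<in> hom k \<Longrightarrow>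
      bracket x (bracket y z) =
        bracket (bracket x y) z + scale (super_sign i j) (bracket y (bracket x z))"

locale lie_supermodule =
  L: lie_superalgebra gscale ghom bracket + V: super_vector_space scale hom
    for gscale :: "complex \<Rightarrow> 'g::ab_group_add \<Rightarrow> 'g" and ghom bracket
    and scale :: "complex \<Rightarrow> 'm::ab_group_add \<Rightarrow> 'm" and hom +
  fixes act :: "'g \<Rightarrow> 'm \<Rightarrow> 'm"
  assumes linear_act_right: "Vector_Spaces.linear scale scale (\<lambda>v. act x v)"
    and linear_act_left: "Vector_Spaces.linear gscale scale (\<lambda>x. act x v)"
    and act_hom: "x \<in> ghom i \<Longrightarrow> v \<in> hom j \<Longrightarrow> act x v \<in> hom (i + j)"
    and act_bracket: "x \<in> ghom i \<Longrightarrow> y \<in> ghom j \<Longrightarrow>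
      act (bracket x y) v = act x (act y v) - scale (super_sign i j) (act y (act x v))"
begin

text \<open>
  Submodules are \<open>\<int>/2\<close>-graded, as usual for modules over Lie superalgebras, and irreducibility
  refers to them.  For a graded module this is the weaker notion of irreducibility.
\<close>

definition submodule :: "'m set \<Rightarrow> bool" where
  "submodule N \<longleftrightarrow> V.subspace N \<and> (\<forall>x. \<forall>v\<in>N. act x v \<in> N) \<and>
     (\<forall>v\<in>N. \<exists>a\<in>N \<inter> hom 0. \<exists>b\<in>N \<inter> hom 1. v = a + b)"

definition irreducible_module :: bool where
  "irreducible_module \<longleftrightarrow> (\<exists>v::'m. v \<noteq> 0) \<and> (\<forall>N. submodule N \<longrightarrow> N = {0} \<or> N = UNIV)"

definition finite_dim :: "'m set \<Rightarrow> bool" where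
  "finite_dim S \<longleftrightarrow> (\<exists>B. finite B \<and> V.span B = S)"

end


section \<open>The super \<open>W(2,2)\<close> algebra\<close>

datatype w22_gen = Lg int | Ig int | Gg int | Hg int

fun gen_parity :: "w22_gen \<Rightarrow> bit" where
  "gen_parity (Lg m) = 0"
| "gen_parity (Ig m) = 0"
| "gen_parity (Gg m) = 1"
| "gen_parity (Hg m) = 1"

type_synonym w22 = "w22_gen \<Rightarrow>\<^sub>0 complex"

abbreviation basis :: "w22_gen \<Rightarrow> w22" where
  "basis a \<equiv> Poly_Mapping.single a 1"

definition w22_scale :: "complex \<Rightarrow> w22 \<Rightarrow> w22" where
  "w22_scale c x = Poly_Mapping.map (\<lambda>t. c * t) x"

definition w22_hom :: "bit \<Rightarrow> w22 set" where
  "w22_hom i = {x. \<forall>a\<in>Poly_Mapping.keys x. gen_parity a = i}"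

text \<open>
  The equations whose first generator comes later in the order \<open>L, I, G, H\<close> are those forced by
  super-antisymmetry.
\<close>

fun gen_bracket :: "w22_gen \<Rightarrow> w22_gen \<Rightarrow> w22" where
  "gen_bracket (Lg m) (Lg n) = w22_scale (of_int (m - n)) (basis (Lg (m + n)))"
| "gen_bracket (Lg m) (Ig n) = w22_scale (of_int (m - n)) (basis (Ig (m + n)))"
| "gen_bracket (Lg m) (Gg n) = w22_scale (of_int m / 2 - of_int n) (basis (Gg (m + n)))"
| "gen_bracket (Lg m) (Hg n) = w22_scale (of_int m / 2 - of_int n) (basis (Hg (m + n)))"
| "gen_bracket (Gg m) (Gg n) = basis (Ig (m + n))"
| "gen_bracket (Ig m) (Gg n) = w22_scale (of_int (m - 2 * n)) (basis (Hg (m + n)))"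
| "gen_bracket (Ig n) (Lg m) = - w22_scale (of_int (m - n)) (basis (Ig (m + n)))"
| "gen_bracket (Gg n) (Lg m) = - w22_scale (of_int m / 2 - of_int n) (basis (Gg (m + n)))"
| "gen_bracket (Hg n) (Lg m) = - w22_scale (of_int m / 2 - of_int n) (basis (Hg (m + n)))"
| "gen_bracket (Gg n) (Ig m) = - w22_scale (of_int (m - 2 * n)) (basis (Hg (m + n)))"
| "gen_bracket (Ig m) (Ig n) = 0"
| "gen_bracket (Ig m) (Hg n) = 0"
| "gen_bracket (Hg m) (Ig n) = 0"
| "gen_bracket (Gg m) (Hg n) = 0"
| "gen_bracket (Hg m) (Gg n) = 0"
| "gen_bracket (Hg m) (Hg n) = 0"

definition w22_bracket :: "w22 \<Rightarrow> w22 \<Rightarrow> w22" where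
  "w22_bracket x y = (\<Sum>a\<in>Poly_Mapping.keys x. \<Sum>b\<in>Poly_Mapping.keys y.
     w22_scale (Poly_Mapping.lookup x a * Poly_Mapping.lookup y b) (gen_bracket a b))"

lemma lookup_w22_scale [simp]:
  "Poly_Mapping.lookup (w22_scale c x) a = c * Poly_Mapping.lookup x a"
  unfolding w22_scale_def by (simp add: Poly_Mapping.map.rep_eq when_def)

interpretation w22_vs: vector_space w22_scale
  by unfold_locales (auto intro!: poly_mapping_eqI simp: lookup_add algebra_simps)

lemma w22_bracket_superset:
  assumes "finite A" "Poly_Mapping.keys x \<subseteq> A" "finite B" "Poly_Mapping.keys y \<subseteq> B"
  shows "w22_bracket x y = (\<Sum>a\<in>A. \<Sum>b\<in>B.
     w22_scale (Poly_Mapping.lookup x a * Poly_Mapping.lookup y b) (gen_bracket a b))"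
proof -
  have "w22_bracket x y = (\<Sum>a\<in>A. \<Sum>b\<in>Poly_Mapping.keys y.
     w22_scale (Poly_Mapping.lookup x a * Poly_Mapping.lookup y b) (gen_bracket a b))"
    unfolding w22_bracket_def using assms
    by (intro sum.mono_neutral_left) (auto simp: in_keys_iff)
  also have "\<dots> = (\<Sum>a\<in>A. \<Sum>b\<in>B.
     w22_scale (Poly_Mapping.lookup x a * Poly_Mapping.lookup y b) (gen_bracket a b))"
    using assms by (intro sum.cong refl sum.mono_neutral_left) (auto simp: in_keys_iff)
  finally show ?thesis .
qed

lemma keys_w22_scale: "Poly_Mapping.keys (w22_scale c x) \<subseteq> Poly_Mapping.keys x"
  by (auto simp: in_keys_iff)

lemma w22_bracket_linear_right: "Vector_Spaces.linear w22_scale w22_scale (\<lambda>y. w22_bracket x y)"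
proof unfold_locales
  fix y z :: w22 and c :: complex
  let ?B = "Poly_Mapping.keys y \<union> Poly_Mapping.keys z"
  note s = w22_bracket_superset[OF finite_keys subset_refl, of ?B]
  show "w22_bracket x (y + z) = w22_bracket x y + w22_bracket x z"
    using keys_add[of y z] 
    by (simp add: s lookup_add algebra_simps w22_vs.scale_left_distrib sum.distrib)
  show "w22_bracket x (w22_scale c y) = w22_scale c (w22_bracket x y)"
    using keys_w22_scale[of c y]
    by (simp add: s subset_trans[OF _ Un_upper1] w22_vs.scale_sum_right mult_ac)
qed

lemma w22_bracket_linear_left: "Vector_Spaces.linear w22_scale w22_scale (\<lambda>x. w22_bracket x y)"
proof unfold_locales
  fix x z :: w22 and c :: complex
  let ?B = "Poly_Mapping.keys x \<union> Poly_Mapping.keys z"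
  note s = w22_bracket_superset[of ?B _ "Poly_Mapping.keys y" y]
  show "w22_bracket (x + z) y = w22_bracket x y + w22_bracket z y"
    using keys_add[of x z] 
    by (simp add: s lookup_add algebra_simps w22_vs.scale_left_distrib sum.distrib)
  show "w22_bracket (w22_scale c x) y = w22_scale c (w22_bracket x y)"
    using keys_w22_scale[of c x]
    by (simp add: s subset_trans[OF _ Un_upper1] w22_vs.scale_sum_right mult_ac)
qed

lemma w22_bracket_basis: "w22_bracket (basis a) (basis b) = gen_bracket a b"
  by (simp add: w22_bracket_def)

lemmas w22_bracket_simps =
  module_hom.add[OF w22_bracket_linear_right[THEN Vector_Spaces.linear.axioms(3)]]
  module_hom.add[OF w22_bracket_linear_left[THEN Vector_Spaces.linear.axioms(3)]]
  module_hom.scale[OF w22_bracket_linear_right[THEN Vector_Spaces.linear.axioms(3)]]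
  module_hom.scale[OF w22_bracket_linear_left[THEN Vector_Spaces.linear.axioms(3)]]

lemmas w22_bracket_zero =
  module_hom.zero[OF w22_bracket_linear_right[THEN Vector_Spaces.linear.axioms(3)]]
  module_hom.zero[OF w22_bracket_linear_left[THEN Vector_Spaces.linear.axioms(3)]]

lemmas w22_bracket_uminus =
  module_hom.neg[OF w22_bracket_linear_right[THEN Vector_Spaces.linear.axioms(3)]]
  module_hom.neg[OF w22_bracket_linear_left[THEN Vector_Spaces.linear.axioms(3)]]

lemma w22_hom_induct [consumes 1, case_names zero add scale basis]:
  assumes "x \<in> w22_hom i"
    and "P 0" "\<And>x y. P x \<Longrightarrow> P y \<Longrightarrow> P (x + y)" "\<And>c x. P x \<Longrightarrow> P (w22_scale c x)"
    and "\<And>a. gen_parity a = i \<Longrightarrow> P (basis a)"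
  shows "P x"
proof -
  have x: "x = (\<Sum>a\<in>Poly_Mapping.keys x. w22_scale (Poly_Mapping.lookup x a) (basis a))"
    by (rule poly_mapping_eqI)
      (auto simp: lookup_sum lookup_single when_def in_keys_iff if_distrib cong: if_cong)
  have "P (\<Sum>a\<in>A. w22_scale (Poly_Mapping.lookup x a) (basis a))"
    if "finite A" "A \<subseteq> Poly_Mapping.keys x" for A
    using that
    by (induction A rule: finite_induct) (use assms in \<open>auto simp: w22_hom_def\<close>)
  from this[OF finite_keys subset_refl] show ?thesis by (subst x)
qed

lemma w22_subspace_hom: "w22_vs.subspace (w22_hom i)"
  unfolding w22_vs.subspace_def w22_hom_def
  using keys_add keys_w22_scale by fastforce

lemma w22_scale_single [simp]:
  "w22_scale c (Poly_Mapping.single a d) = Poly_Mapping.single a (c * d)"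
  by (rule poly_mapping_eqI) (simp add: lookup_single when_def)

lemma gen_bracket_hom: "gen_bracket a b \<in> w22_hom (gen_parity a + gen_parity b)"
  by (cases a; cases b) (auto simp: w22_hom_def simp flip: single_uminus split: if_splits)

lemma gen_bracket_antisym:
  "gen_bracket a b = - w22_scale (super_sign (gen_parity a) (gen_parity b)) (gen_bracket b a)"
  by (cases a; cases b)
    (auto simp: super_sign_def add.commute algebra_simps simp flip: single_uminus)

lemma single_eqI: "c = d \<Longrightarrow> Poly_Mapping.single a c = Poly_Mapping.single a d"
  by simp

lemma gen_bracket_jacobi:
  "w22_bracket (basis a) (gen_bracket b c) = w22_bracket (gen_bracket a b) (basis c) +
     w22_scale (super_sign (gen_parity a) (gen_parity b))
       (w22_bracket (basis b) (gen_bracket a c))"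
proof -
  have r: "w22_bracket (Poly_Mapping.single a c) (Poly_Mapping.single b d) =
      w22_scale (c * d) (gen_bracket a b)" for a b c d
    by (simp add: w22_bracket_def)
  show ?thesis
    by (cases a; cases b; cases c)
      (simp_all add: r super_sign_def w22_bracket_zero w22_bracket_uminus add.assoc add.left_commute
          add.commute  flip: single_add single_uminus single_diff,
        (rule single_eqI, simp add: field_simps)+)
qed

interpretation w22: lie_superalgebra w22_scale w22_hom w22_bracket
proof (intro lie_superalgebra.intro lie_superalgebra_axioms.intro super_vector_space.intro
    super_vector_space_axioms.intro)
  show "vector_space w22_scale" by (rule w22_vs.vector_space_axioms)
  show "w22_vs.subspace (w22_hom i)" for i by (rule w22_subspace_hom)
  show "w22_hom 0 \<inter> w22_hom 1 = {0}"
    by (auto simp: w22_hom_def simp flip: keys_eq_empty)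
  show "\<exists>a\<in>w22_hom 0. \<exists>b\<in>w22_hom 1. v = a + b" for v
  proof -
    have P: "\<exists>p. \<forall>a. Poly_Mapping.lookup p a =
        (if gen_parity a = i then Poly_Mapping.lookup v a else 0)" for i
    proof -
      have "finite {a. (if gen_parity a = i then Poly_Mapping.lookup v a else 0) \<noteq> 0}"
        by (rule finite_subset[OF _ finite_keys[of v]]) (auto simp: in_keys_iff)
      from lookup_Abs_poly_mapping[OF this, THEN fun_cong] show ?thesis by (intro exI allI)
    qed
    from P[of 0] P[of 1] obtain p q where
      p: "\<And>a. Poly_Mapping.lookup p a = (if gen_parity a = 0 then Poly_Mapping.lookup v a else 0)" and
      q: "\<And>a. Poly_Mapping.lookup q a = (if gen_parity a = 1 then Poly_Mapping.lookup v a else 0)"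
      by blast
    have "v = p + q" by (rule poly_mapping_eqI) (auto simp: lookup_add p q)
    moreover have "p \<in> w22_hom 0" "q \<in> w22_hom 1"
      by (auto simp: w22_hom_def in_keys_iff p q split: if_splits)
    ultimately show ?thesis by blast
  qed
  show "Vector_Spaces.linear w22_scale w22_scale (\<lambda>y. w22_bracket x y)" for x
    by (rule w22_bracket_linear_right)
  show "Vector_Spaces.linear w22_scale w22_scale (\<lambda>x. w22_bracket x y)" for y
    by (rule w22_bracket_linear_left)
  fix x y z i j k
  note sub = w22_subspace_hom[unfolded w22_vs.subspace_def]
  note simps = w22_bracket_simps w22_bracket_basis w22_bracket_zero w22_bracket_uminus
    w22_vs.scale_right_distrib
  assume x: "x \<in> w22_hom i" and y: "y \<in> w22_hom j"
  show "w22_bracket x y \<in> w22_hom (i + j)"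
    using x
  proof (induction rule: w22_hom_induct)
    case a: (basis a)
    show ?case using y
    proof (induction rule: w22_hom_induct)
      case b: (basis b)
      show ?case
        by (simp only: w22_bracket_basis a[symmetric] b[symmetric] gen_bracket_hom)
    qed (use sub in \<open>auto simp: simps\<close>)
  qed (use sub in \<open>auto simp: simps\<close>)
  show "w22_bracket x y = - w22_scale (super_sign i j) (w22_bracket y x)"
    using x
  proof (induction rule: w22_hom_induct)
    case a: (basis a)
    show ?case using y
    proof (induction rule: w22_hom_induct)
      case b: (basis b)
      show ?case
        unfolding w22_bracket_basis a[symmetric] b[symmetric] by (rule gen_bracket_antisym)
    qed (auto simp: simps mult.commute)
  qed (auto simp: simps mult.commute)
  assume z: "z \<in> w22_hom k"
  show "w22_bracket x (w22_bracket y z) = w22_bracket (w22_bracket x y) z +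
      w22_scale (super_sign i j) (w22_bracket y (w22_bracket x z))"
    using x
  proof (induction rule: w22_hom_induct)
    case a: (basis a)
    show ?case using y
    proof (induction rule: w22_hom_induct)
      case b: (basis b)
      show ?case using z
      proof (induction rule: w22_hom_induct)
        case (basis c)
        show ?case
          unfolding w22_bracket_basis a[symmetric] b[symmetric] by (rule gen_bracket_jacobi)
      qed (auto simp: simps mult.commute)
    qed (auto simp: simps mult.commute)
  qed (auto simp: simps mult.commute)
qed


section \<open>Weight modules\<close>

locale w22_module =
  lie_supermodule w22_scale w22_hom w22_bracket scale hom act
    for scale :: "complex \<Rightarrow> 'm::ab_group_add \<Rightarrow> 'm" and hom and act :: "w22 \<Rightarrow> 'm \<Rightarrow> 'm"
begin

definition weight_space :: "complex \<Rightarrow> 'm set" where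
  "weight_space \<alpha> = {x. act (basis (Lg 0)) x = scale (- \<alpha>) x}"

text \<open>The module is the (internal) direct sum of its weight spaces.\<close>

definition weight_module :: bool where
  "weight_module \<longleftrightarrow> (\<forall>v. \<exists>!f. finite {\<alpha>. f \<alpha> \<noteq> 0} \<and> (\<forall>\<alpha>. f \<alpha> \<in> weight_space \<alpha>) \<and>
     v = (\<Sum>\<alpha> | f \<alpha> \<noteq> 0. f \<alpha>))"

definition Supp :: "complex set" where
  "Supp = {\<alpha>. weight_space \<alpha> \<noteq> {0}}"

definition mixed :: bool where
  "mixed \<longleftrightarrow> weight_module \<and>
     (\<exists>\<alpha>\<in>Supp. \<exists>\<beta>\<in>Supp. \<not> finite_dim (weight_space \<alpha>) \<and> finite_dim (weight_space \<beta>))"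

end

end

theory Submission
  imports Defs
begin

text \<open>
  Suppose \<open>M \<alpha>\<close> is infinite-dimensional and \<open>M (\<alpha> + 1)\<close> finite-dimensional; reversing the
  grading by a duality covers the other case.  Any finite collection of words in the algebra
  passing through \<open>M (\<alpha> + 1)\<close> has a common kernel of finite codimension in \<open>M \<alpha>\<close>, so finitely
  many computations with a generic \<open>v\<close> in \<open>M \<alpha>\<close> may be done as if \<open>M (\<alpha> + 1) = 0\<close>.  On the other
  hand there are no singular vectors (killed by all elements of positive, or all of negative
  degree), since these would make all weight spaces finite-dimensional.

  Comparing \<open>L\<^sub>-\<^sub>2 L\<^sub>2\<close> on \<open>M \<alpha>\<close> with \<open>L\<^sub>2 L\<^sub>-\<^sub>2\<close> on \<open>M (\<alpha> + 2)\<close> forces \<open>\<alpha> = - 1\<close>.  There the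
  ideal spanned by the \<open>G\<^sub>n, I\<^sub>n, H\<^sub>n\<close> kills \<open>v\<close>, hence the module, and \<open>v\<close> generates a copy of the
  Witt module of Laurent polynomials modulo constants, which has finite-dimensional weight
  spaces.
\<close>

section \<open>Representations given by the basis elements and a parity operator\<close>

fun deg :: "w22_gen \<Rightarrow> int" where
  "deg (Lg m) = m"
| "deg (Ig m) = m"
| "deg (Gg m) = m"
| "deg (Hg m) = m"

lemma finite_deg: "finite {a. deg a = d}"
proof (rule finite_subset)
  show "{a. deg a = d} \<subseteq> {Lg d, Ig d, Gg d, Hg d}"
  proof
    fix a assume "a \<in> {a. deg a = d}"
    then show "a \<in> {Lg d, Ig d, Gg d, Hg d}" by (cases a) auto
  qed
qed simp

text \<open>The involution \<open>P\<close> encodes the grading, so that graded submodules are the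
  subspaces stable under \<open>P\<close> and all \<open>\<rho> a\<close>. Only basis elements act,
  so reindexing and rescaling them yields a new instance.\<close>

locale w22_rep = vector_space scale
  for scale :: "complex \<Rightarrow> 'm::ab_group_add \<Rightarrow> 'm" (infixr \<open>*s\<close> 75) +
  fixes \<rho> :: "w22_gen \<Rightarrow> 'm \<Rightarrow> 'm" and P :: "'m \<Rightarrow> 'm"
  assumes linear_\<rho>: "Vector_Spaces.linear scale scale (\<rho> a)"
    and linear_P: "Vector_Spaces.linear scale scale P"
    and LL: "\<rho> (Lg m) (\<rho> (Lg n) v) =
      \<rho> (Lg n) (\<rho> (Lg m) v) + of_int (m - n) *s \<rho> (Lg (m + n)) v"
    and LI: "\<rho> (Lg m) (\<rho> (Ig n) v) =
      \<rho> (Ig n) (\<rho> (Lg m) v) + of_int (m - n) *s \<rho> (Ig (m + n)) v"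
    and LG: "\<rho> (Lg m) (\<rho> (Gg n) v) =
      \<rho> (Gg n) (\<rho> (Lg m) v) + (of_int m / 2 - of_int n) *s \<rho> (Gg (m + n)) v"
    and LH: "\<rho> (Lg m) (\<rho> (Hg n) v) =
      \<rho> (Hg n) (\<rho> (Lg m) v) + (of_int m / 2 - of_int n) *s \<rho> (Hg (m + n)) v"
    and GG: "\<rho> (Gg m) (\<rho> (Gg n) v) = - \<rho> (Gg n) (\<rho> (Gg m) v) + \<rho> (Ig (m + n)) v"
    and IG: "\<rho> (Ig m) (\<rho> (Gg n) v) =
      \<rho> (Gg n) (\<rho> (Ig m) v) + of_int (m - 2 * n) *s \<rho> (Hg (m + n)) v"
    and II: "\<rho> (Ig m) (\<rho> (Ig n) v) = \<rho> (Ig n) (\<rho> (Ig m) v)"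
    and IH: "\<rho> (Ig m) (\<rho> (Hg n) v) = \<rho> (Hg n) (\<rho> (Ig m) v)"
    and GH: "\<rho> (Gg m) (\<rho> (Hg n) v) = - \<rho> (Hg n) (\<rho> (Gg m) v)"
    and HH: "\<rho> (Hg m) (\<rho> (Hg n) v) = - \<rho> (Hg n) (\<rho> (Hg m) v)"
    and P_\<rho>: "P (\<rho> a v) = (if gen_parity a = 0 then \<rho> a (P v) else - \<rho> a (P v))"
    and P_P: "P (P v) = v"
    and irreducible: "\<lbrakk>subspace N; \<And>a v. v \<in> N \<Longrightarrow> \<rho> a v \<in> N; \<And>v. v \<in> N \<Longrightarrow> P v \<in> N\<rbrakk>
      \<Longrightarrow> N = {0} \<or> N = UNIV"
begin

lemmas \<rho>_simps [simp] =
  module_hom.add[OF linear_\<rho>[THEN Vector_Spaces.linear.axioms(3)]]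
  module_hom.scale[OF linear_\<rho>[THEN Vector_Spaces.linear.axioms(3)]]
  module_hom.zero[OF linear_\<rho>[THEN Vector_Spaces.linear.axioms(3)]]
  module_hom.neg[OF linear_\<rho>[THEN Vector_Spaces.linear.axioms(3)]]
  module_hom.diff[OF linear_\<rho>[THEN Vector_Spaces.linear.axioms(3)]]
  module_hom.sum[OF linear_\<rho>[THEN Vector_Spaces.linear.axioms(3)]]

lemmas P_simps [simp] =
  module_hom.add[OF linear_P[THEN Vector_Spaces.linear.axioms(3)]]
  module_hom.scale[OF linear_P[THEN Vector_Spaces.linear.axioms(3)]]
  module_hom.zero[OF linear_P[THEN Vector_Spaces.linear.axioms(3)]]
  module_hom.neg[OF linear_P[THEN Vector_Spaces.linear.axioms(3)]]

abbreviation "L n \<equiv> \<rho> (Lg n)"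
abbreviation "I n \<equiv> \<rho> (Ig n)"
abbreviation "G n \<equiv> \<rho> (Gg n)"
abbreviation "H n \<equiv> \<rho> (Hg n)"

definition M :: "complex \<Rightarrow> 'm set" where
  "M \<alpha> = {v. L 0 v = (- \<alpha>) *s v}"

definition fd :: "'m set \<Rightarrow> bool" where
  "fd S \<longleftrightarrow> (\<exists>B. finite B \<and> S \<subseteq> span B)"

text \<open>The growth arguments need only that exchanging two letters costs a term of the total
  degree.\<close>

lemma commute:
  "\<exists>s t c. deg c = deg a + deg b \<and> (\<forall>v. \<rho> a (\<rho> b v) = s *s \<rho> b (\<rho> a v) + t *s \<rho> c v)"
proof -
  \<comment> \<open>\<open>s \<noteq> 0\<close> is carried along so that the relation can be solved
    for the opposite order in \<open>swap\<close>.\<close>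
  define Q where "Q a b \<longleftrightarrow> (\<exists>s t c. s \<noteq> 0 \<and> deg c = deg a + deg b \<and>
    (\<forall>v. \<rho> a (\<rho> b v) = s *s \<rho> b (\<rho> a v) + t *s \<rho> c v))" for a b
  have QI: "Q a b" if "deg c = deg a + deg b" "s \<noteq> 0"
    "\<And>v. \<rho> a (\<rho> b v) = s *s \<rho> b (\<rho> a v) + t *s \<rho> c v" for a b c s t
    unfolding Q_def using that by blast
  have swap: "Q b a" if ab: "Q a b" for a b
  proof -
    from ab obtain s t c where *: "deg c = deg a + deg b" "s \<noteq> 0"
      "\<And>v. \<rho> a (\<rho> b v) = s *s \<rho> b (\<rho> a v) + t *s \<rho> c v"
      unfolding Q_def by blast
    show ?thesis
    proof (rule QI)
      show "deg c = deg b + deg a" using * by simp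
      show "\<rho> b (\<rho> a v) = (1 / s) *s \<rho> a (\<rho> b v) + (- t / s) *s \<rho> c v" for v
        using *(2) by (subst *(3)) (simp add: scale_right_distrib)
    qed (use * in simp)
  qed
  have "Q (Lg m) (Lg n)" for m n
    by (rule QI[of "Lg (m + n)" _ _ 1 "of_int (m - n)"]) (auto simp: LL[of m n])
  moreover have "Q (Lg m) (Ig n)" for m n
    by (rule QI[of "Ig (m + n)" _ _ 1 "of_int (m - n)"]) (auto simp: LI[of m n])
  moreover have "Q (Lg m) (Gg n)" for m n
    by (rule QI[of "Gg (m + n)" _ _ 1 "of_int m / 2 - of_int n"]) (auto simp: LG[of m n])
  moreover have "Q (Lg m) (Hg n)" for m n
    by (rule QI[of "Hg (m + n)" _ _ 1 "of_int m / 2 - of_int n"]) (auto simp: LH[of m n])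
  moreover have "Q (Ig m) (Ig n)" for m n
    by (rule QI[of "Ig (m + n)" _ _ 1 0]) (auto simp: II[of m n])
  moreover have "Q (Ig m) (Gg n)" for m n
    by (rule QI[of "Hg (m + n)" _ _ 1 "of_int (m - 2 * n)"]) (auto simp: IG[of m n])
  moreover have "Q (Ig m) (Hg n)" for m n
    by (rule QI[of "Hg (m + n)" _ _ 1 0]) (auto simp: IH[of m n])
  moreover have "Q (Gg m) (Gg n)" for m n
    by (rule QI[of "Ig (m + n)" _ _ "-1" 1]) (auto simp: GG[of m n])
  moreover have "Q (Gg m) (Hg n)" for m n
    by (rule QI[of "Hg (m + n)" _ _ "-1" 0]) (auto simp: GH[of m n])
  moreover have "Q (Hg m) (Hg n)" for m n
    by (rule QI[of "Hg (m + n)" _ _ "-1" 0]) (auto simp: HH[of m n])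
  ultimately have "Q a b" by (cases a; cases b) (auto intro: swap)
  then show ?thesis unfolding Q_def by blast
qed

section \<open>Weight spaces\<close>

lemma subspace_M: "subspace (M \<alpha>)"
  by (auto simp: subspace_def M_def scale_right_distrib mult.commute)

lemma \<rho>_M:
  assumes "v \<in> M \<alpha>"
  shows "\<rho> a v \<in> M (\<alpha> + of_int (deg a))"
proof (cases a)
  case (Lg n) then show ?thesis using assms
    by (auto simp: M_def LL[of 0 n] algebra_simps)
next
  case (Ig n) then show ?thesis using assms
    by (auto simp: M_def LI[of 0 n] algebra_simps)
next
  case (Gg n) then show ?thesis using assms
    by (auto simp: M_def LG[of 0 n] algebra_simps)
next
  case (Hg n) then show ?thesis using assms
    by (auto simp: M_def LH[of 0 n] algebra_simps)
qed

lemma P_M: "v \<in> M \<alpha> \<Longrightarrow> P v \<in> M \<alpha>"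
  using P_\<rho>[of "Lg 0" v] by (auto simp: M_def)

text \<open>Applying \<open>L 0 + \<kappa>\<close> removes one component and multiplies the others
  by nonzero factors.\<close>

lemma weight_components:
  assumes "finite F" and "\<And>\<alpha>. \<alpha> \<in> F \<Longrightarrow> f \<alpha> \<in> M \<alpha>" and "(\<Sum>\<alpha>\<in>F. f \<alpha>) = 0"
  shows "\<forall>\<alpha>\<in>F. f \<alpha> = 0"
  using assms
proof (induction F arbitrary: f rule: finite_induct)
  case (insert \<kappa> F)
  have w: "L 0 (f \<alpha>) = (- \<alpha>) *s f \<alpha>" if "\<alpha> \<in> insert \<kappa> F" for \<alpha>
    using insert.prems(1)[OF that] by (simp add: M_def)
  have "0 = L 0 (\<Sum>\<alpha>\<in>insert \<kappa> F. f \<alpha>) + \<kappa> *s (\<Sum>\<alpha>\<in>insert \<kappa> F. f \<alpha>)"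
    using insert.prems(2) by simp
  also have "\<dots> = (\<Sum>\<alpha>\<in>insert \<kappa> F. L 0 (f \<alpha>) + \<kappa> *s f \<alpha>)"
    by (simp only: \<rho>_simps scale_sum_right sum.distrib)
  also have "\<dots> = (\<Sum>\<alpha>\<in>insert \<kappa> F. (\<kappa> - \<alpha>) *s f \<alpha>)"
    by (rule sum.cong) (simp_all add: w algebra_simps)
  also have "\<dots> = (\<Sum>\<alpha>\<in>F. (\<kappa> - \<alpha>) *s f \<alpha>)"
    using insert.hyps by simp
  finally have "\<forall>\<alpha>\<in>F. (\<kappa> - \<alpha>) *s f \<alpha> = 0"
    using insert.prems(1) subspace_M by (intro insert.IH) (auto simp: subspace_def)
  then have z: "\<forall>\<alpha>\<in>F. f \<alpha> = 0"
    using insert.hyps by auto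
  then have "f \<kappa> = 0" using insert.prems(2) insert.hyps by simp
  with z show ?case by simp
qed simp

text \<open>Weight components are unique, so weight subspaces that together span the module exhaust
  each weight space. This turns a generating set into a bound on supports and dimensions.\<close>

lemma spanning_weight_family:
  assumes span: "span (\<Union>\<alpha>\<in>A. S \<alpha>) = UNIV"
    and S: "\<And>\<alpha>. \<alpha> \<in> A \<Longrightarrow> subspace (S \<alpha>)" "\<And>\<alpha>. \<alpha> \<in> A \<Longrightarrow> S \<alpha> \<subseteq> M \<alpha>"
    and x: "x \<in> M \<nu>" "x \<noteq> 0"
  shows "\<nu> \<in> A \<and> x \<in> S \<nu>"
proof -
  have "\<exists>F f. finite F \<and> F \<subseteq> A \<and> (\<forall>\<alpha>\<in>A. f \<alpha> \<in> S \<alpha>) \<and> (\<forall>\<alpha>. \<alpha> \<notin> F \<longrightarrow> f \<alpha> = 0) \<and> x = (\<Sum>\<alpha>\<in>F. f \<alpha>)"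
    if "x \<in> span (\<Union>\<alpha>\<in>A. S \<alpha>)" for x
    using that
  proof (induction rule: span_induct_alt)
    case base
    then show ?case
      using S(1) by (intro exI[of _ "{}"] exI[of _ "\<lambda>_. 0"]) (auto simp: subspace_def)
  next
    case (step c x y)
    then obtain \<kappa> F f where \<kappa>: "\<kappa> \<in> A" "x \<in> S \<kappa>" and f: "finite F" "F \<subseteq> A"
      "\<forall>\<alpha>\<in>A. f \<alpha> \<in> S \<alpha>" "\<forall>\<alpha>. \<alpha> \<notin> F \<longrightarrow> f \<alpha> = 0" "y = (\<Sum>\<alpha>\<in>F. f \<alpha>)"
      by blast
    let ?f = "f(\<kappa> := c *s x + f \<kappa>)"
    have "(\<Sum>\<alpha>\<in>insert \<kappa> F. ?f \<alpha>) = c *s x + f \<kappa> + (\<Sum>\<alpha>\<in>F - {\<kappa>}. f \<alpha>)"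
      using f(1) by (simp add: sum.insert_remove)
    also have "\<dots> = c *s x + (f \<kappa> + (\<Sum>\<alpha>\<in>F - {\<kappa>}. f \<alpha>))" by (simp add: add.assoc)
    also have "f \<kappa> + (\<Sum>\<alpha>\<in>F - {\<kappa>}. f \<alpha>) = y"
      using f by (cases "\<kappa> \<in> F") (auto simp: sum.remove)
    finally have "c *s x + y = (\<Sum>\<alpha>\<in>insert \<kappa> F. ?f \<alpha>)" by simp
    with f \<kappa> S(1) show ?case
      by (intro exI[of _ "insert \<kappa> F"] exI[of _ ?f]) (auto simp: subspace_def)
  qed
  from this[of x] obtain F f where f: "finite F" "F \<subseteq> A"
      "\<forall>\<alpha>\<in>A. f \<alpha> \<in> S \<alpha>" "\<forall>\<alpha>. \<alpha> \<notin> F \<longrightarrow> f \<alpha> = 0" "x = (\<Sum>\<alpha>\<in>F. f \<alpha>)"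
    using span by blast
  let ?g = "f(\<nu> := f \<nu> - x)"
  have "(\<Sum>\<alpha>\<in>insert \<nu> F. ?g \<alpha>) = f \<nu> - x + (\<Sum>\<alpha>\<in>F - {\<nu>}. f \<alpha>)"
    using f(1) by (simp add: sum.insert_remove)
  also have "\<dots> = (f \<nu> + (\<Sum>\<alpha>\<in>F - {\<nu>}. f \<alpha>)) - x" by simp
  also have "f \<nu> + (\<Sum>\<alpha>\<in>F - {\<nu>}. f \<alpha>) = x"
    using f by (cases "\<nu> \<in> F") (auto simp: sum.remove)
  finally have "(\<Sum>\<alpha>\<in>insert \<nu> F. ?g \<alpha>) = 0" by simp
  moreover have "?g \<alpha> \<in> M \<alpha>" if "\<alpha> \<in> insert \<nu> F" for \<alpha>
  proof -
    have "f \<alpha> \<in> M \<alpha>" using f S subspace_0[OF subspace_M] by (cases "\<alpha> \<in> F") fastforce+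
    then show ?thesis using x(1) subspace_diff[OF subspace_M] by auto
  qed
  ultimately have "?g \<nu> = 0" using f(1) weight_components[of "insert \<nu> F" ?g] by blast
  then have "f \<nu> = x" by simp
  moreover from this have "\<nu> \<in> F" using f(4) x(2) by metis
  ultimately show ?thesis using f(2,3) by (metis subsetD)
qed

section \<open>Submodules generated by one-sided growth\<close>

text \<open>For \<open>s\<close> equal to 1 or -1, level \<open>n\<close> is the degree
  \<open>s * n\<close> part of what the enveloping algebra of the half of sign \<open>s\<close>
  makes of \<open>X\<close>.\<close>

inductive grow :: "int \<Rightarrow> 'm set \<Rightarrow> nat \<Rightarrow> 'm \<Rightarrow> bool" for s X where
  grow_base: "x \<in> X \<Longrightarrow> grow s X 0 x"
| grow_step: "grow s X n x \<Longrightarrow> deg a = s * int (Suc k) \<Longrightarrow> grow s X (n + Suc k) (\<rho> a x)"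
| grow_zero: "grow s X n 0"
| grow_add: "grow s X n x \<Longrightarrow> grow s X n y \<Longrightarrow> grow s X n (x + y)"
| grow_scale: "grow s X n x \<Longrightarrow> grow s X n (c *s x)"

lemma subspace_grow: "subspace {x. grow s X n x}"
  by (auto simp: subspace_def intro: grow.intros)

lemma grow_M:
  assumes "grow s X n x" "X \<subseteq> M \<kappa>"
  shows "x \<in> M (\<kappa> + of_int (s * int n))"
  using assms
proof induction
  case (grow_step n x a k)
  then show ?case using \<rho>_M[of x "\<kappa> + of_int (s * int n)" a] by (auto simp: algebra_simps)
qed (use subspace_M in \<open>auto simp: subspace_def\<close>)

lemma grow_P:
  assumes "grow s X n x" "\<And>x. x \<in> X \<Longrightarrow> P x \<in> X"
  shows "grow s X n (P x)"
  using assms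
proof induction
  case (grow_step n x a k)
  then have "grow s X (n + Suc k) (\<rho> a (P x))" "grow s X (n + Suc k) ((- 1) *s \<rho> a (P x))"
    by (auto intro!: grow.intros(2,5) simp del: add_Suc_right of_nat_Suc scale_minus_left)
  then show ?case by (simp add: P_\<rho>)
qed (auto intro: grow.intros)

lemma grow_fd:
  assumes "fd X"
  shows "fd {x. grow s X n x}"
proof (induction n rule: less_induct)
  case (less n)
  obtain B0 where B0: "finite B0" "X \<subseteq> span B0" using assms by (auto simp: fd_def)
  have "\<exists>B. \<forall>k<n. finite (B k) \<and> {x. grow s X (n - Suc k) x} \<subseteq> span (B k)"
    using less[of "n - Suc _"] unfolding fd_def
    by (intro choice) (metis diff_less zero_less_Suc gr_implies_not0 neq0_conv)
  then obtain B where B: "\<And>k. k < n \<Longrightarrow> finite (B k)"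
    "\<And>k. k < n \<Longrightarrow> {x. grow s X (n - Suc k) x} \<subseteq> span (B k)" by blast
  \<comment> \<open>The outermost letter of a word at level \<open>n\<close> has degree
    \<open>s\<close> times a number from 1 to \<open>n\<close>, and each degree has finitely many
    letters.\<close>
  define C where "C = B0 \<union> (\<Union>k\<in>{..<n}. \<Union>a\<in>{a. deg a = s * int (Suc k)}. \<rho> a ` B k)"
  have "x \<in> span C" if "grow s X m x" "m = n" for x m
    using that
  proof induction
    case (grow_base x)
    then show ?case using B0 span_mono[of B0 C] by (auto simp: C_def)
  next
    case (grow_step m x a k)
    then have k: "k < n" "m = n - Suc k" by auto
    then have "x \<in> span (B k)" using B(2)[of k] grow_step by auto
    then have "\<rho> a x \<in> span (\<rho> a ` B k)"
      by (induction rule: span_induct_alt) (auto intro: span_zero span_add span_scale span_base)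
    moreover have "\<rho> a ` B k \<subseteq> C" using k grow_step(2) by (auto simp: C_def)
    ultimately show ?case using span_mono by blast
  qed (auto intro: span_zero span_add span_scale)
  moreover have "finite C" using B0 B by (auto simp: C_def finite_deg)
  ultimately show ?case by (auto simp: fd_def)
qed

text \<open>The letter \<open>a\<close> is pushed inward: the exchanged product and the commutator
  term both involve \<open>x\<close>, a shorter word. \<open>K\<close> limits which opposite letters
  must kill \<open>X\<close>; for \<open>K = 0\<close> none must, and only letters of degree zero
  are treated.\<close>

lemma grow_opposite:
  assumes "\<And>a x. deg a = 0 \<Longrightarrow> x \<in> X \<Longrightarrow> \<rho> a x \<in> X"
    and "\<And>a x l. deg a = - s * int (Suc l) \<Longrightarrow> Suc l \<le> K \<Longrightarrow> x \<in> X \<Longrightarrow> \<rho> a x = 0"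
    and "grow s X n x" "l \<le> K" "deg a = - s * int l"
  shows "(l \<le> n \<longrightarrow> grow s X (n - l) (\<rho> a x)) \<and> (n < l \<longrightarrow> \<rho> a x = 0)"
  using assms(3-)
proof (induction arbitrary: a l)
  case (grow_base x)
  then show ?case using assms(1,2) by (cases l) (auto intro: grow.grow_base)
next
  case (grow_step n x b k)
  obtain r t c where c: "deg c = deg a + deg b"
    "\<And>v. \<rho> a (\<rho> b v) = r *s \<rho> b (\<rho> a v) + t *s \<rho> c v"
    using commute[of a b] by blast
  have IH: "(l \<le> n \<longrightarrow> grow s X (n - l) (\<rho> a x)) \<and> (n < l \<longrightarrow> \<rho> a x = 0)"
    using grow_step by blast
  have 1: "grow s X (n + Suc k - l) (\<rho> b (\<rho> a x))" if "l \<le> n + Suc k"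
  proof (cases "l \<le> n")
    case True
    then have "grow s X (n - l + Suc k) (\<rho> b (\<rho> a x))"
      using IH grow_step.hyps(2) by (intro grow.grow_step) auto
    then show ?thesis using True by (simp add: Suc_diff_le)
  qed (use IH grow.grow_zero in auto)
  have 2: "(l \<le> n + Suc k \<longrightarrow> grow s X (n + Suc k - l) (\<rho> c x)) \<and> (n + Suc k < l \<longrightarrow> \<rho> c x = 0)"
  proof (cases "Suc k \<le> l")
    case True
    then have "deg c = - s * int (l - Suc k)"
      using c(1) grow_step by (simp add: of_nat_diff algebra_simps)
    then have "(l - Suc k \<le> n \<longrightarrow> grow s X (n - (l - Suc k)) (\<rho> c x)) \<and>
        (n < l - Suc k \<longrightarrow> \<rho> c x = 0)"
      using grow_step.prems by (intro grow_step.IH) auto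
    moreover have "n - (l - Suc k) = n + Suc k - l" using True by simp
    ultimately show ?thesis using True by auto
  next
    case False
    then have "deg c = s * int (Suc (k - l))"
      using c(1) grow_step by (simp add: of_nat_diff algebra_simps)
    then have "grow s X (n + Suc (k - l)) (\<rho> c x)"
      using grow_step.hyps by (intro grow.grow_step) auto
    then show ?thesis using False by (simp add: Suc_diff_le)
  qed
  show ?case
  proof (intro conjI impI)
    assume "l \<le> n + Suc k"
    then show "grow s X (n + Suc k - l) (\<rho> a (\<rho> b x))"
      unfolding c(2) using 1 2 by (intro grow.grow_add grow.grow_scale) auto
  next
    assume "n + Suc k < l"
    then show "\<rho> a (\<rho> b x) = 0" unfolding c(2) using IH 2 by simp
  qed
qed (auto intro: grow.intros)

text \<open>Triangular decomposition: the degree zero part preserves \<open>X\<close> and the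
  opposite half kills it, so the levels together span a submodule, hence everything; weights
  identify the level.\<close>

lemma grow_UNIV:
  assumes "s = 1 \<or> s = -1" and "X \<subseteq> M \<kappa>" "x0 \<in> X" "x0 \<noteq> 0"
    and "\<And>x. x \<in> X \<Longrightarrow> P x \<in> X"
    and 0: "\<And>a x. deg a = 0 \<Longrightarrow> x \<in> X \<Longrightarrow> \<rho> a x \<in> X"
    and opp: "\<And>a x l. deg a = - s * int (Suc l) \<Longrightarrow> x \<in> X \<Longrightarrow> \<rho> a x = 0"
    and y: "y \<in> M \<nu>" "y \<noteq> 0"
  shows "\<exists>n. \<nu> = \<kappa> + of_int (s * int n) \<and> grow s X n y"
proof -
  define w where "w n = \<kappa> + of_int (s * int n)" for n
  have inj: "w m = w n \<Longrightarrow> m = n" for m n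
    using assms(1) unfolding w_def by auto
  define S where "S \<alpha> = {x. \<exists>n. \<alpha> = w n \<and> grow s X n x}" for \<alpha>
  have S: "S (w n) = {x. grow s X n x}" for n
    unfolding S_def using inj by auto
  define N where "N = span (\<Union>\<alpha>\<in>range w. S \<alpha>)"
  have "\<rho> a x \<in> N" if "x \<in> N" for a x
    using that unfolding N_def
  proof (induction rule: span_induct_alt)
    case (step c x y)
    then obtain n where n: "grow s X n x" by (auto simp: S)
    have "\<exists>m. grow s X m (\<rho> a x)"
    proof -
      consider l where "deg a = - s * int l" | l where "deg a = s * int (Suc l)"
      proof -
        have "\<exists>l. deg a = int l \<or> deg a = - int l" by (metis int_cases2)
        then obtain l where l: "deg a = int l \<or> deg a = - int l" by blast
        show thesis
        proof (cases l)
          case 0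
          then show thesis using l that(1)[of 0] by auto
        next
          case (Suc k)
          then show thesis using l assms(1) that(1)[of l] that(2)[of k] by auto
        qed
      qed
      then show ?thesis
      proof cases
        case (1 l)
        have "(l \<le> n \<longrightarrow> grow s X (n - l) (\<rho> a x)) \<and> (n < l \<longrightarrow> \<rho> a x = 0)"
          by (rule grow_opposite[where K = l]) (use 0 opp n 1 in auto)
        then show ?thesis using grow_zero by (metis not_le)
      next
        case 2
        then show ?thesis using grow_step[OF n] by blast
      qed
    qed
    then have "\<rho> a x \<in> span (\<Union>\<alpha>\<in>range w. S \<alpha>)" by (auto simp: S intro: span_base)
    with step show ?case by (auto intro: span_add span_scale)
  qed (auto intro: span_zero)
  moreover have "P x \<in> N" if "x \<in> N" for x
    using that unfolding N_def
  proof (induction rule: span_induct_alt)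
    case (step c x y)
    then obtain n where "grow s X n x" by (auto simp: S)
    then have "grow s X n (P x)" by (rule grow_P) (rule assms(5))
    then have "P x \<in> span (\<Union>\<alpha>\<in>range w. S \<alpha>)" by (auto simp: S intro: span_base)
    with step show ?case by (auto intro: span_add span_scale)
  qed (auto intro: span_zero)
  moreover have "x0 \<in> N"
    unfolding N_def using assms(3) by (intro span_base) (auto simp: S intro!: exI[of _ 0] grow_base)
  ultimately have "N = UNIV" using irreducible[of N] assms(4) unfolding N_def by fastforce
  moreover have "S \<alpha> \<subseteq> M \<alpha>" for \<alpha>
    using grow_M assms(2) unfolding S_def w_def by blast
  moreover have "subspace (S \<alpha>)" if "\<alpha> \<in> range w" for \<alpha>
    using that subspace_grow by (auto simp: S)
  ultimately have "\<nu> \<in> range w \<and> y \<in> S \<nu>"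
    using y unfolding N_def by (intro spanning_weight_family) auto
  then show ?thesis unfolding S_def w_def by blast
qed

section \<open>Generators of the positive part\<close>

lemma scale_two: "2 *s x = x + x"
  by (metis one_add_one scale_left_distrib scale_one)

lemma fd_subset: "fd S \<Longrightarrow> T \<subseteq> S \<Longrightarrow> fd T"
  unfolding fd_def by blast

lemma fd_zero: "fd {0}"
  by (auto simp: fd_def intro!: exI[of _ "{}"])

lemma half_int_neq: "of_int m / 2 - of_int n \<noteq> (0 :: complex)" if "odd m"
proof
  assume "of_int m / 2 - of_int n = (0 :: complex)"
  then have "of_int m = (of_int (2 * n) :: complex)" by (simp add: field_simps)
  then show False using that unfolding of_int_eq_iff by presburger
qed

text \<open>The five elements generate the positive half. Brackets of \<open>L 1\<close> with
  \<open>G n\<close> and \<open>H n\<close> never vanish, while those with \<open>L n\<close> and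
  \<open>I n\<close> vanish at \<open>n = 1\<close>.\<close>

lemma raising_zero:
  assumes "L 1 u = 0" "L 2 u = 0" "G 1 u = 0" "I 1 u = 0" "H 1 u = 0" and "0 < deg a"
  shows "\<rho> a u = 0"
proof -
  have nz: "1 + of_nat j \<noteq> (0 :: complex)" "- 1 \<noteq> (of_nat j :: complex)" for j
    using of_nat_neq_0[of j, where 'a = complex] by (auto simp: neg_eq_iff_add_eq_0)
  have G: "G (int (Suc k)) u = 0" for k
  proof (induction k)
    case (Suc k)
    then show ?case using LG[of 1 "int (Suc k)" u] assms half_int_neq[of 1 "int (Suc k)"]
      by (simp add: add_ac)
  qed (use assms in simp)
  have H: "H (int (Suc k)) u = 0" for k
  proof (induction k)
    case (Suc k)
    then show ?case using LH[of 1 "int (Suc k)" u] assms half_int_neq[of 1 "int (Suc k)"]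
      by (simp add: add_ac)
  qed (use assms in simp)
  have L: "L (int (Suc k)) u = 0" for k
  proof (induction k)
    case (Suc k)
    then show ?case using LL[of "int (Suc k)" 1 u] assms nz by (cases k) (simp_all add: add_ac)
  qed (use assms in simp)
  have I: "I (int (Suc k)) u = 0" for k
  proof (induction k)
    case (Suc k)
    \<comment> \<open>Since \<open>[L 1, I 1] = 0\<close>, the element \<open>I 2\<close> is
      obtained from \<open>[G 1, G 1]\<close>.\<close>
    have "I 2 u = 0" using GG[of 1 1 u] assms by simp
    with Suc show ?case using LI[of 1 "int (Suc k)" u] assms nz by (cases k) (simp_all add: add_ac)
  qed (use assms in simp)
  obtain k where "deg a = int (Suc k)"
    using assms(6) by (metis zero_less_imp_eq_int gr0_implies_Suc)
  then show ?thesis by (cases a) (simp_all only: deg.simps L G I H)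
qed

end

text \<open>The situation to be refuted; as a locale it can be instantiated with the reversed
  grading, which gives every result a mirror image.\<close>

locale w22_mixed = w22_rep scale \<rho> P
  for scale :: "complex \<Rightarrow> 'm::ab_group_add \<Rightarrow> 'm" (infixr \<open>*s\<close> 75)
    and \<rho> :: "w22_gen \<Rightarrow> 'm \<Rightarrow> 'm" and P :: "'m \<Rightarrow> 'm" +
  assumes fd_weight: "\<exists>\<mu>. M \<mu> \<noteq> {0} \<and> fd (M \<mu>)"
    and not_fd_weight: "\<exists>\<alpha>. \<not> fd (M \<alpha>)"
begin

section \<open>Absence of singular vectors\<close>

text \<open>A singular vector bounds the weights above. Climbing from a finite-dimensional weight
  space then stops at a finite-dimensional space of singular vectors, and growing down from there
  leaves only finite-dimensional weight spaces.\<close>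

lemma no_singular:
  assumes u: "u \<in> M \<kappa>" "L 1 u = 0" "L 2 u = 0" "G 1 u = 0" "I 1 u = 0" "H 1 u = 0"
  shows "u = 0"
proof (rule ccontr)
  assume "u \<noteq> 0"
  define X where "X = {x \<in> M \<kappa>. \<forall>a. 0 < deg a \<longrightarrow> \<rho> a x = 0}"
  have "\<rho> a x \<in> X" if "deg a = 0" "x \<in> X" for a x
  proof -
    have "\<rho> b (\<rho> a x) = 0" if "0 < deg b" for b
      using commute[of b a] that \<open>deg a = 0\<close> \<open>x \<in> X\<close> by (auto simp: X_def)
    then show ?thesis using \<rho>_M[of x \<kappa> a] that by (auto simp: X_def)
  qed
  moreover have "P x \<in> X" if "x \<in> X" for x
  proof -
    have "\<rho> a (P x) = 0" if "\<rho> a x = 0" for a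
      using P_\<rho>[of a x] that by (auto split: if_splits)
    then show ?thesis using that P_M by (auto simp: X_def)
  qed
  moreover have "u \<in> X" using u raising_zero by (auto simp: X_def)
  ultimately have bounded: "\<exists>n. \<nu> = \<kappa> - of_nat n" if "y \<in> M \<nu>" "y \<noteq> 0" for y \<nu>
    using grow_UNIV[of "-1" X \<kappa> u y \<nu>] that \<open>u \<noteq> 0\<close> by (force simp: X_def)
  obtain \<mu> y0 where \<mu>: "fd (M \<mu>)" "y0 \<in> M \<mu>" "y0 \<noteq> 0"
    using fd_weight subspace_0[OF subspace_M] by blast
  \<comment> \<open>\<open>X\<close> may be infinite-dimensional, so it bounds weights but not
    dimensions. The last nonzero level \<open>T\<close> of the climb from \<open>M \<mu>\<close>
    replaces it.\<close>
  define D where "D = {n. \<exists>x. x \<noteq> 0 \<and> grow 1 (M \<mu>) n x}"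
  obtain n0 where n0: "\<mu> = \<kappa> - of_nat n0" using bounded \<mu> by blast
  have "n \<le> n0" if "n \<in> D" for n
  proof -
    obtain x where "x \<noteq> 0" "x \<in> M (\<mu> + of_nat n)"
      using \<open>n \<in> D\<close> grow_M[of 1 "M \<mu>" n _ \<mu>] by (auto simp: D_def)
    then obtain n' where "\<mu> + of_nat n = \<kappa> - of_nat n'" using bounded by blast
    then have "of_nat (n + n') = (of_nat n0 :: complex)" using n0 by (simp add: algebra_simps)
    then show ?thesis unfolding of_nat_eq_iff by simp
  qed
  then have "finite D" by (meson finite_nat_set_iff_bounded_le)
  moreover have "0 \<in> D" using \<mu> grow_base by (auto simp: D_def)
  ultimately have n: "Max D \<in> D" "\<And>m. m \<in> D \<Longrightarrow> m \<le> Max D"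
    using Max_in by auto
  define n where "n = Max D"
  define T where "T = {x. grow 1 (M \<mu>) n x}"
  obtain x0 where x0: "x0 \<in> T" "x0 \<noteq> 0" using n(1) by (auto simp: n_def T_def D_def)
  have T: "T \<subseteq> M (\<mu> + of_nat n)" using grow_M[of 1 "M \<mu>" n _ \<mu>] by (auto simp: T_def)
  have inv: "\<rho> a x \<in> T" if "deg a = 0" "x \<in> T" for a x
  proof -
    have "(0 \<le> n \<longrightarrow> grow 1 (M \<mu>) (n - 0) (\<rho> a x)) \<and> (n < 0 \<longrightarrow> \<rho> a x = 0)"
    proof (rule grow_opposite[where K = 0])
      show "\<rho> a x \<in> M \<mu>" if "deg a = 0" "x \<in> M \<mu>" for a x
        using \<rho>_M[OF that(2), of a] that(1) by simp
    qed (use that in \<open>auto simp: T_def\<close>)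
    then show ?thesis by (simp add: T_def)
  qed
  have Pinv: "P x \<in> T" if "x \<in> T" for x
    using that grow_P P_M by (auto simp: T_def)
  have kill: "\<rho> a x = 0" if "deg a = int (Suc l)" "x \<in> T" for a x l
  proof (rule ccontr)
    assume "\<rho> a x \<noteq> 0"
    moreover have "grow 1 (M \<mu>) (n + Suc l) (\<rho> a x)"
      using that by (intro grow_step) (auto simp: T_def)
    ultimately show False using n(2)[of "n + Suc l"] by (auto simp: D_def n_def)
  qed
  obtain \<alpha> where \<alpha>: "\<not> fd (M \<alpha>)" using not_fd_weight by blast
  have ex: "\<exists>m. \<alpha> = \<mu> + of_nat n - of_nat m \<and> grow (-1) T m y" if "y \<in> M \<alpha>" "y \<noteq> 0" for y
    using grow_UNIV[of "-1" T "\<mu> + of_nat n" x0 y \<alpha>] x0 T inv Pinv kill that by force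
  obtain y where "y \<in> M \<alpha>" "y \<noteq> 0" using \<alpha> fd_zero fd_subset[of "{0}" "M \<alpha>"] by blast
  then obtain m where m: "\<alpha> = \<mu> + of_nat n - of_nat m" using ex by blast
  have "M \<alpha> \<subseteq> {y. grow (-1) T m y}"
    using ex m grow_zero by force
  moreover have "fd {y. grow (-1) T m y}"
    using grow_fd[OF \<mu>(1)] by (intro grow_fd) (auto simp: T_def)
  ultimately show False using \<alpha> by (auto simp: fd_def)
qed

section \<open>Generic vectors\<close>

text \<open>\<open>Q\<close> holds on a subspace of finite codimension. Giving that subspace by test
  maps makes passing from \<open>v\<close> to \<open>\<rho> a v\<close> a composition of
  maps.\<close>

definition gen :: "complex \<Rightarrow> ('m \<Rightarrow> bool) \<Rightarrow> bool" where
  "gen \<alpha> Q \<longleftrightarrow> (\<exists>\<Phi>. finite \<Phi> \<and> (\<forall>f\<in>\<Phi>. Vector_Spaces.linear scale scale f \<and> fd (f ` M \<alpha>)) \<and>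
     (\<forall>v\<in>M \<alpha>. (\<forall>f\<in>\<Phi>. f v = 0) \<longrightarrow> Q v))"

lemma gen_conj: "gen \<alpha> Q \<Longrightarrow> gen \<alpha> R \<Longrightarrow> gen \<alpha> (\<lambda>v. Q v \<and> R v)"
  unfolding gen_def
proof (elim exE)
  fix \<Phi> \<Psi>
  assume "finite \<Phi> \<and> (\<forall>f\<in>\<Phi>. Vector_Spaces.linear scale scale f \<and> fd (f ` M \<alpha>)) \<and>
     (\<forall>v\<in>M \<alpha>. (\<forall>f\<in>\<Phi>. f v = 0) \<longrightarrow> Q v)"
  moreover assume "finite \<Psi> \<and> (\<forall>f\<in>\<Psi>. Vector_Spaces.linear scale scale f \<and> fd (f ` M \<alpha>)) \<and>
     (\<forall>v\<in>M \<alpha>. (\<forall>f\<in>\<Psi>. f v = 0) \<longrightarrow> R v)"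
  ultimately show "\<exists>\<Phi>. finite \<Phi> \<and> (\<forall>f\<in>\<Phi>. Vector_Spaces.linear scale scale f \<and> fd (f ` M \<alpha>)) \<and>
     (\<forall>v\<in>M \<alpha>. (\<forall>f\<in>\<Phi>. f v = 0) \<longrightarrow> Q v \<and> R v)"
    by (intro exI[of _ "\<Phi> \<union> \<Psi>"]) auto
qed

lemma gen_mono: "gen \<alpha> Q \<Longrightarrow> (\<And>v. v \<in> M \<alpha> \<Longrightarrow> Q v \<Longrightarrow> R v) \<Longrightarrow> gen \<alpha> R"
  unfolding gen_def by meson

lemma gen_fd: "fd (M \<alpha>) \<Longrightarrow> gen \<alpha> (\<lambda>v. v = 0)"
  unfolding gen_def
  by (intro exI[of _ "{\<lambda>v. v}"]) (auto simp: linear_ident)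

lemma gen_compose:
  assumes "gen (\<alpha> + of_int (deg a)) Q"
  shows "gen \<alpha> (\<lambda>v. Q (\<rho> a v))"
proof -
  obtain \<Phi> where \<Phi>: "finite \<Phi>"
    "\<And>f. f \<in> \<Phi> \<Longrightarrow> Vector_Spaces.linear scale scale f \<and> fd (f ` M (\<alpha> + of_int (deg a)))"
    "\<And>v. v \<in> M (\<alpha> + of_int (deg a)) \<Longrightarrow> \<forall>f\<in>\<Phi>. f v = 0 \<Longrightarrow> Q v"
    using assms unfolding gen_def by blast
  have "Vector_Spaces.linear scale scale (f \<circ> \<rho> a) \<and> fd ((f \<circ> \<rho> a) ` M \<alpha>)" if "f \<in> \<Phi>" for f
  proof
    show "Vector_Spaces.linear scale scale (f \<circ> \<rho> a)"
      using \<Phi>(2)[OF that] linear_\<rho> by (auto intro: Vector_Spaces.linear_compose)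
    show "fd ((f \<circ> \<rho> a) ` M \<alpha>)"
      by (rule fd_subset[of "f ` M (\<alpha> + of_int (deg a))"]) (use \<Phi>(2)[OF that] \<rho>_M in auto)
  qed
  then show ?thesis
    unfolding gen_def using \<Phi>(1,3) \<rho>_M by (intro exI[of _ "(\<lambda>f. f \<circ> \<rho> a) ` \<Phi>"]) auto
qed

text \<open>Rank and nullity: a finite set spanning the kernel and lifts of a basis of the image
  would together span \<open>S\<close>.\<close>

lemma kernel_not_fd:
  assumes f: "Vector_Spaces.linear scale scale f" "fd (f ` S)" and S: "subspace S" "\<not> fd S"
  shows "\<not> fd {v \<in> S. f v = 0}"
proof
  assume "fd {v \<in> S. f v = 0}"
  then obtain B where B: "finite B" "{v \<in> S. f v = 0} \<subseteq> span B" by (auto simp: fd_def)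
  interpret f: Vector_Spaces.linear scale scale f by fact
  obtain C where C: "finite C" "f ` S \<subseteq> span C" using f(2) by (auto simp: fd_def)
  obtain D where D: "D \<subseteq> f ` S" "independent D" "f ` S \<subseteq> span D"
    using maximal_independent_subset by blast
  have "finite D" using independent_span_bound[OF C(1) D(2)] D(1) C(2) by auto
  obtain E where E: "E \<subseteq> S" "finite E" "D = f ` E"
    using finite_subset_image[OF \<open>finite D\<close> D(1)] by blast
  have "v \<in> span (B \<union> E)" if "v \<in> S" for v
  proof -
    have "f v \<in> f ` span E"
      using D(3) that E(3) f.span_image by auto
    then obtain w where w: "w \<in> span E" "f v = f w" by auto
    then have "w \<in> S" using E(1) S(1) span_minimal by blast
    then have "v - w \<in> span B"
      using B(2) w that S(1) by (auto simp: f.diff subspace_diff)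
    then have "(v - w) + w \<in> span (B \<union> E)"
      using w(1) span_mono[of B "B \<union> E"] span_mono[of E "B \<union> E"] by (intro span_add) auto
    then show ?thesis by simp
  qed
  then show False using S(2) B(1) E(2) unfolding fd_def by blast
qed

lemma gen_exists:
  assumes "gen \<alpha> Q" "\<not> fd (M \<alpha>)"
  shows "\<exists>v\<in>M \<alpha>. v \<noteq> 0 \<and> Q v"
proof -
  obtain \<Phi> where \<Phi>: "finite \<Phi>" "\<forall>f\<in>\<Phi>. Vector_Spaces.linear scale scale f \<and> fd (f ` M \<alpha>)"
    "\<forall>v\<in>M \<alpha>. (\<forall>f\<in>\<Phi>. f v = 0) \<longrightarrow> Q v"
    using assms unfolding gen_def by blast
  from \<Phi>(1,2) have "subspace {v \<in> M \<alpha>. \<forall>f\<in>\<Phi>. f v = 0} \<and> \<not> fd {v \<in> M \<alpha>. \<forall>f\<in>\<Phi>. f v = 0}"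
  proof (induction rule: finite_induct)
    case empty
    then show ?case using subspace_M assms(2) by simp
  next
    case (insert f \<Phi>)
    interpret f: Vector_Spaces.linear scale scale f using insert by simp
    define S where "S = {v \<in> M \<alpha>. \<forall>f\<in>\<Phi>. f v = 0}"
    have S: "subspace S" "\<not> fd S" using insert by (auto simp: S_def)
    have eq: "{v \<in> M \<alpha>. \<forall>g\<in>insert f \<Phi>. g v = 0} = {v \<in> S. f v = 0}" by (auto simp: S_def)
    have "fd (f ` S)" using insert by (auto intro: fd_subset[of "f ` M \<alpha>"] simp: S_def)
    then have "\<not> fd {v \<in> S. f v = 0}"
      using insert.prems S by (intro kernel_not_fd) auto
    moreover have "subspace {v \<in> S. f v = 0}"
      using S(1) by (auto simp: subspace_def f.add f.scale)
    ultimately show ?case unfolding eq by blast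
  qed
  then obtain v where "v \<in> {v \<in> M \<alpha>. \<forall>f\<in>\<Phi>. f v = 0}" "v \<noteq> 0"
    using fd_zero fd_subset[of "{0}"] by blast
  then show ?thesis using \<Phi>(3) by blast
qed

end

section \<open>The duality reversing the grading\<close>

fun mirror_gen :: "w22_gen \<Rightarrow> w22_gen" where
  "mirror_gen (Lg n) = Lg (- n)"
| "mirror_gen (Ig n) = Ig (- n)"
| "mirror_gen (Gg n) = Gg (- n)"
| "mirror_gen (Hg n) = Hg (- n)"

text \<open>With \<open>mirror_gen\<close> this is an automorphism of the superalgebra. As
  \<open>I\<close> gets \<open>- 1\<close>, the relation \<open>[G m, G n] = I (m + n)\<close> asks
  for a square root of \<open>- 1\<close> on \<open>G\<close>.\<close>

fun mirror_coeff :: "w22_gen \<Rightarrow> complex" where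
  "mirror_coeff (Lg n) = - 1"
| "mirror_coeff (Ig n) = - 1"
| "mirror_coeff (Gg n) = \<i>"
| "mirror_coeff (Hg n) = \<i>"

context w22_mixed
begin

definition \<rho>' :: "w22_gen \<Rightarrow> 'm \<Rightarrow> 'm" where
  "\<rho>' a v = mirror_coeff a *s \<rho> (mirror_gen a) v"

lemma mirror_rep: "w22_rep scale \<rho>' P"
proof unfold_locales
  show "\<rho>' a (x + y) = \<rho>' a x + \<rho>' a y" "\<rho>' a (r *s x) = r *s \<rho>' a x" for a r x y
    by (simp_all add: \<rho>'_def scale_right_distrib mult.commute)
  show "P (x + y) = P x + P y" "P (r *s x) = r *s P x" for r x y by simp_all
  fix m n v
  show "\<rho>' (Lg m) (\<rho>' (Lg n) v) =
      \<rho>' (Lg n) (\<rho>' (Lg m) v) + of_int (m - n) *s \<rho>' (Lg (m + n)) v"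
    by (simp add: \<rho>'_def LL[of "- m" "- n"] scale_left_diff_distrib)
  show "\<rho>' (Lg m) (\<rho>' (Ig n) v) =
      \<rho>' (Ig n) (\<rho>' (Lg m) v) + of_int (m - n) *s \<rho>' (Ig (m + n)) v"
    by (simp add: \<rho>'_def LI[of "- m" "- n"] scale_left_diff_distrib)
  show "\<rho>' (Lg m) (\<rho>' (Gg n) v) =
      \<rho>' (Gg n) (\<rho>' (Lg m) v) + (of_int m / 2 - of_int n) *s \<rho>' (Gg (m + n)) v"
    by (simp add: \<rho>'_def LG[of "- m" "- n"] algebra_simps)
  show "\<rho>' (Lg m) (\<rho>' (Hg n) v) =
      \<rho>' (Hg n) (\<rho>' (Lg m) v) + (of_int m / 2 - of_int n) *s \<rho>' (Hg (m + n)) v"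
    by (simp add: \<rho>'_def LH[of "- m" "- n"] algebra_simps)
  show "\<rho>' (Gg m) (\<rho>' (Gg n) v) = - \<rho>' (Gg n) (\<rho>' (Gg m) v) + \<rho>' (Ig (m + n)) v"
    by (simp add: \<rho>'_def GG[of "- m" "- n"])
  show "\<rho>' (Ig m) (\<rho>' (Gg n) v) =
      \<rho>' (Gg n) (\<rho>' (Ig m) v) + of_int (m - 2 * n) *s \<rho>' (Hg (m + n)) v"
    by (simp add: \<rho>'_def IG[of "- m" "- n"] algebra_simps)
  show "\<rho>' (Ig m) (\<rho>' (Ig n) v) = \<rho>' (Ig n) (\<rho>' (Ig m) v)"
    by (simp add: \<rho>'_def II[of "- m" "- n"])
  show "\<rho>' (Ig m) (\<rho>' (Hg n) v) = \<rho>' (Hg n) (\<rho>' (Ig m) v)"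
    by (simp add: \<rho>'_def IH[of "- m" "- n"])
  show "\<rho>' (Gg m) (\<rho>' (Hg n) v) = - \<rho>' (Hg n) (\<rho>' (Gg m) v)"
    by (simp add: \<rho>'_def GH[of "- m" "- n"])
  show "\<rho>' (Hg m) (\<rho>' (Hg n) v) = - \<rho>' (Hg n) (\<rho>' (Hg m) v)"
    by (simp add: \<rho>'_def HH[of "- m" "- n"])
  show "P (\<rho>' a v) = (if gen_parity a = 0 then \<rho>' a (P v) else - \<rho>' a (P v))" for a
    by (cases a) (simp_all add: \<rho>'_def P_\<rho>)
  show "P (P v) = v" by (rule P_P)
next
  fix N assume N: "subspace N" "\<And>a v. v \<in> N \<Longrightarrow> \<rho>' a v \<in> N" "\<And>v. v \<in> N \<Longrightarrow> P v \<in> N"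
  have "\<rho> a v \<in> N" if "v \<in> N" for a v
  proof -
    have "(1 / mirror_coeff (mirror_gen a)) *s \<rho>' (mirror_gen a) v \<in> N"
      using N(1,2) that by (simp add: subspace_scale)
    then show ?thesis by (cases a) (simp_all add: \<rho>'_def)
  qed
  then show "N = {0} \<or> N = UNIV" using N irreducible by blast
qed

lemma mirror_M: "w22_rep.M scale \<rho>' \<alpha> = M (- \<alpha>)"
  unfolding w22_rep.M_def[OF mirror_rep] M_def
  by (auto simp: \<rho>'_def)

lemma mirror: "w22_mixed scale \<rho>' P"
proof (intro w22_mixed.intro w22_mixed_axioms.intro)
  show "w22_rep scale \<rho>' P" by (rule mirror_rep)
  show "\<exists>\<mu>. w22_rep.M scale \<rho>' \<mu> \<noteq> {0} \<and> fd (w22_rep.M scale \<rho>' \<mu>)"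
    unfolding mirror_M using fd_weight by (metis minus_minus)
  show "\<exists>\<alpha>. \<not> fd (w22_rep.M scale \<rho>' \<alpha>)"
    unfolding mirror_M using not_fd_weight by (metis minus_minus)
qed

lemma mirror_gen: "w22_mixed.gen scale \<rho>' \<alpha> Q = gen (- \<alpha>) Q"
  unfolding w22_mixed.gen_def[OF mirror] gen_def mirror_M ..

lemma no_lowest:
  assumes "w \<in> M \<kappa>" "L (- 1) w = 0" "L (- 2) w = 0" "G (- 1) w = 0" "I (- 1) w = 0" "H (- 1) w = 0"
  shows "w = 0"
  by (rule w22_mixed.no_singular[OF mirror, of w "- \<kappa>"])
    (use assms in \<open>simp_all add: mirror_M \<rho>'_def\<close>)

section \<open>Crossing a finite-dimensional weight space\<close>

lemma L_0: "v \<in> M \<alpha> \<Longrightarrow> L 0 v = (- \<alpha>) *s v"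
  by (simp add: M_def)

lemma gen_\<rho>: "gen \<kappa> Q \<Longrightarrow> \<kappa> = \<alpha> + of_int (deg a) \<Longrightarrow> gen \<alpha> (\<lambda>v. Q (\<rho> a v))"
  using gen_compose by blast

lemma gen_\<rho>_fd: "fd (M \<kappa>) \<Longrightarrow> \<kappa> = \<alpha> + of_int (deg a) \<Longrightarrow> gen \<alpha> (\<lambda>v. \<rho> a v = 0)"
  using gen_\<rho> gen_fd by blast

text \<open>Of the generators in \<open>raising_zero\<close> only \<open>L 2\<close> is left out: it
  jumps over the weight \<open>\<alpha> + 1\<close>, and is the only way up for a generic
  vector.\<close>

definition killed_up :: "'m \<Rightarrow> bool" where
  "killed_up v \<longleftrightarrow> L 1 v = 0 \<and> G 1 v = 0 \<and> I 1 v = 0 \<and> H 1 v = 0"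

definition killed_down :: "'m \<Rightarrow> bool" where
  "killed_down v \<longleftrightarrow> L (- 1) v = 0 \<and> G (- 1) v = 0 \<and> I (- 1) v = 0 \<and> H (- 1) v = 0"

lemma gen_killed_up: "fd (M (\<alpha> + 1)) \<Longrightarrow> gen \<alpha> killed_up"
  unfolding killed_up_def by (intro gen_conj gen_\<rho>_fd) auto

lemma gen_killed_down: "fd (M (\<alpha> - 1)) \<Longrightarrow> gen \<alpha> killed_down"
  unfolding killed_down_def by (intro gen_conj gen_\<rho>_fd) auto

lemma killed_up_eq_0: "v \<in> M \<alpha> \<Longrightarrow> killed_up v \<Longrightarrow> L 2 v = 0 \<Longrightarrow> v = 0"
  unfolding killed_up_def using no_singular by blast

lemma killed_down_eq_0: "v \<in> M \<alpha> \<Longrightarrow> killed_down v \<Longrightarrow> L (- 2) v = 0 \<Longrightarrow> v = 0"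
  unfolding killed_down_def using no_lowest by blast

text \<open>
  The hypotheses are those available when \<open>M (\<alpha> + 1) = 0\<close>.  Computing
  \<open>L\<^sub>5 L\<^sub>-\<^sub>1 v\<close> from \<open>L\<^sub>5 = - [L\<^sub>2, L\<^sub>3]\<close> and from \<open>L\<^sub>5 = - [L\<^sub>1, L\<^sub>4] / 3\<close> gives
  \<open>L\<^sub>4 v = - L\<^sub>2 L\<^sub>2 v\<close>, to which \<open>L\<^sub>-\<^sub>2\<close> is applied.
\<close>

lemma L2_pairing:
  assumes v: "v \<in> M \<alpha>" and "\<alpha> \<noteq> 0"
    and h1: "L 1 v = 0" and h2: "L (- 1) (L 2 v) = 0" and h3: "L (- 2) (L 3 v) = 0"
  shows "L 2 (L (- 2) (L 2 v) + (\<alpha> + 2) *s v) = 0"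
proof -
  define x where "x = L (- 1) v"
  have w0: "L 0 (L 2 v) = (- (\<alpha> + 2)) *s L 2 v"
    using \<rho>_M[OF v, of "Lg 2"] by (simp add: M_def)
  have x2: "L 2 x = 0" using LL[of 2 "- 1" v] h1 h2 by (simp add: x_def)
  have x1: "L 1 x = (- (2 * \<alpha>)) *s v" using LL[of 1 "- 1" v] h1 L_0[OF v] by (simp add: x_def)
  have v3: "L 3 v = - L 1 (L 2 v)" using LL[of 1 2 v] h1 by simp
  have v4: "L 1 (L 3 v) = (- 2) *s L 4 v" using LL[of 1 3 v] h1 by simp
  have x3: "L 3 x = (- (2 * \<alpha>)) *s L 2 v" using LL[of 1 2 x] x1 x2 by simp
  have "2 *s L 4 x = L 3 (L 1 x) - L 1 (L 3 x)"
    using LL[of 3 1 x] by simp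
  also have "\<dots> = 2 *s ((- (2 * \<alpha>)) *s L 3 v)"
    by (simp add: x1 x3 v3 flip: scale_left_distrib)
  finally have x4: "L 4 x = (- (2 * \<alpha>)) *s L 3 v" by (simp only: scale_cancel_left) simp
  have x5: "L 5 x = (2 * \<alpha>) *s L 2 (L 2 v)" 
  proof -
    have "L 5 x = - L 2 (L 3 x)" using LL[of 2 3 x] x2 by simp
    then show ?thesis by (simp add: x3)
  qed
  have "(- 3) *s L 5 x = L 1 (L 4 x) - L 4 (L 1 x)"
    using LL[of 1 4 x] by simp
  also have "\<dots> = (6 * \<alpha>) *s L 4 v"
    by (simp add: x1 x4 v4 flip: scale_left_distrib)
  finally have "(6 * \<alpha>) *s L 4 v = (6 * \<alpha>) *s (- L 2 (L 2 v))" by (simp add: x5)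
  then have L4: "L 4 v = - L 2 (L 2 v)" using \<open>\<alpha> \<noteq> 0\<close> by (simp only: scale_cancel_left) simp
  have "L (- 1) (L 1 (L 2 v)) = (2 * (\<alpha> + 2)) *s L 2 v"
    using LL[of "- 1" 1 "L 2 v"] h2 w0 by simp
  then have "L (- 1) (L 3 v) = (- (2 * (\<alpha> + 2))) *s L 2 v"
    by (simp only: v3 \<rho>_simps scale_minus_left)
  then have "L (- 2) (L 1 (L 3 v)) = (6 * (\<alpha> + 2)) *s L 2 v"
    using LL[of "- 2" 1 "L 3 v"] h3 by simp
  then have "(- 2) *s L (- 2) (L 4 v) = (- 2) *s ((- (3 * (\<alpha> + 2))) *s L 2 v)"
    by (simp add: v4)
  then have "L (- 2) (L 4 v) = (- (3 * (\<alpha> + 2))) *s L 2 v" by (simp only: scale_cancel_left) simp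
  then have "L (- 2) (L 2 (L 2 v)) = (3 * (\<alpha> + 2)) *s L 2 v"
    unfolding L4 by (simp only: \<rho>_simps scale_minus_left neg_equal_iff_equal)
  \<comment> \<open>A second evaluation of the same vector; the factors 3 and 4 in front of
    \<open>\<alpha> + 2\<close> leave the correction term of the claim.\<close>
  moreover have "L (- 2) (L 2 (L 2 v)) = L 2 (L (- 2) (L 2 v)) + (4 * (\<alpha> + 2)) *s L 2 v"
    using LL[of "- 2" 2 "L 2 v"] w0 by simp
  ultimately have "L 2 (L (- 2) (L 2 v)) = (3 * (\<alpha> + 2) - 4 * (\<alpha> + 2)) *s L 2 v"
    by (metis add_diff_cancel_right' scale_left_diff_distrib)
  then show ?thesis by (simp flip: scale_left_distrib)
qed

text \<open>The vector \<open>z\<close> is killed by \<open>L 2\<close> through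
  \<open>L2_pairing\<close> and generically by the degree one generators, hence singular and zero.
  All conditions collected concern words passing through \<open>M (\<alpha> + 1)\<close>.\<close>

lemma gen_L2_pairing:
  assumes fd: "fd (M (\<alpha> + 1))" and "\<alpha> \<noteq> 0"
  shows "gen \<alpha> (\<lambda>v. L (- 2) (L 2 v) = (- (\<alpha> + 2)) *s v)"
proof -
  have "gen \<alpha> (\<lambda>v. (killed_up v \<and> killed_up (L (- 2) (L 2 v))) \<and> L (- 1) (L 2 v) = 0 \<and> L (- 2) (L 3 v) = 0)"
    by (intro gen_conj gen_killed_up gen_\<rho>[where Q = "\<lambda>v. killed_up (\<rho> _ v)"] gen_\<rho>[where Q = killed_up]
      gen_\<rho>[where Q = "\<lambda>v. \<rho> _ v = 0"] gen_\<rho>_fd[OF fd]) (use fd in \<open>auto simp: add_ac\<close>)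
  then show ?thesis
  proof (rule gen_mono, elim conjE)
    fix v
    assume v: "v \<in> M \<alpha>" and n: "killed_up v" "killed_up (L (- 2) (L 2 v))"
      and h: "L (- 1) (L 2 v) = 0" "L (- 2) (L 3 v) = 0"
    define z where "z = L (- 2) (L 2 v) + (\<alpha> + 2) *s v"
    have "L (- 2) (L 2 v) \<in> M \<alpha>" using \<rho>_M[OF \<rho>_M[OF v, of "Lg 2"], of "Lg (- 2)"] by simp
    then have "z \<in> M \<alpha>" using v subspace_M by (auto simp: z_def intro: subspace_add subspace_scale)
    moreover have "killed_up z" using n by (simp add: killed_up_def z_def)
    moreover have "L 2 z = 0" unfolding z_def
      using n by (intro L2_pairing[OF v \<open>\<alpha> \<noteq> 0\<close> _ h]) (simp add: killed_up_def)
    ultimately have "z = 0" by (rule killed_up_eq_0)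
    then show "L (- 2) (L 2 v) = (- (\<alpha> + 2)) *s v"
      by (simp add: z_def eq_neg_iff_add_eq_0 scale_left_diff_distrib algebra_simps)
  qed
qed

lemma gen_L2_pairing':
  assumes "fd (M (\<kappa> - 1))" and "\<kappa> \<noteq> 0"
  shows "gen \<kappa> (\<lambda>w. L 2 (L (- 2) w) = (\<kappa> - 2) *s w)"
  using w22_mixed.gen_L2_pairing[OF mirror, of "- \<kappa>"] assms
  by (simp add: mirror_M mirror_gen \<rho>'_def)

text \<open>The finite-dimensional space lies between the weights \<open>\<alpha>\<close> and
  \<open>\<kappa>\<close>. Evaluating \<open>L 2 (L (- 2) (L 2 v))\<close> from either side gives
  \<open>- \<kappa>\<close> and \<open>\<alpha>\<close> times the nonzero vector
  \<open>L 2 v\<close>.\<close>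

lemma adjacent_weight:
  assumes inf: "\<not> fd (M \<alpha>)" and fd: "fd (M (\<alpha> + 1))"
  shows "\<alpha> = - 1"
proof -
  define \<kappa> where "\<kappa> = \<alpha> + 2"
  have fd': "fd (M (\<kappa> - 1))" using fd by (simp add: \<kappa>_def algebra_simps)
  \<comment> \<open>For \<open>\<alpha> = 0\<close> the implication is vacuous, and any generic
    property, here \<open>killed_up\<close>, serves to derive it.\<close>
  have 1: "gen \<alpha> (\<lambda>v. \<alpha> \<noteq> 0 \<longrightarrow> L (- 2) (L 2 v) = (- \<kappa>) *s v)"
    using gen_L2_pairing[OF fd] gen_killed_up[OF fd] unfolding \<kappa>_def
    by (cases "\<alpha> = 0") (auto intro: gen_mono)
  have 2: "gen \<kappa> (\<lambda>w. \<kappa> \<noteq> 0 \<longrightarrow> L 2 (L (- 2) w) = \<alpha> *s w)"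
    using gen_L2_pairing'[OF fd'] gen_killed_down[OF fd']
    by (cases "\<kappa> = 0") (auto intro: gen_mono simp: \<kappa>_def)
  have "gen \<alpha> (\<lambda>v. (killed_up v \<and> killed_up (L (- 2) (L 2 v)) \<and> killed_down (L 2 v)) \<and>
      (\<alpha> \<noteq> 0 \<longrightarrow> L (- 2) (L 2 v) = (- \<kappa>) *s v) \<and>
      (\<kappa> \<noteq> 0 \<longrightarrow> L 2 (L (- 2) (L 2 v)) = \<alpha> *s L 2 v))"
    using fd fd'
    by (intro gen_conj gen_killed_up 1 gen_\<rho>[where Q = "\<lambda>v. killed_up (\<rho> _ v)"] gen_\<rho>[where Q = killed_up]
      gen_\<rho>[where Q = killed_down] gen_killed_down gen_\<rho>[OF 2]) (auto simp: \<kappa>_def algebra_simps)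
  then obtain v where v: "v \<in> M \<alpha>" "v \<noteq> 0" and n: "killed_up v" "killed_up (L (- 2) (L 2 v))" "killed_down (L 2 v)"
    and T: "\<alpha> \<noteq> 0 \<Longrightarrow> L (- 2) (L 2 v) = (- \<kappa>) *s v"
      "\<kappa> \<noteq> 0 \<Longrightarrow> L 2 (L (- 2) (L 2 v)) = \<alpha> *s L 2 v"
    using gen_exists[OF _ inf] by blast
  have w: "L 2 v \<in> M \<kappa>" "L (- 2) (L 2 v) \<in> M \<alpha>"
    using \<rho>_M[OF v(1), of "Lg 2"] \<rho>_M[OF \<rho>_M[OF v(1), of "Lg 2"], of "Lg (- 2)"]
    by (simp_all add: \<kappa>_def)
  have w0: "L 2 v \<noteq> 0" using killed_up_eq_0 v n by blast
  then have z0: "L (- 2) (L 2 v) \<noteq> 0" using killed_down_eq_0 w n by blast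
  \<comment> \<open>\<open>\<kappa> = 0\<close> would make the product on \<open>v\<close> vanish,
    and \<open>\<alpha> = 0\<close> the one on \<open>L 2 v\<close>; the absence of singular vectors
    excludes both.\<close>
  have "\<kappa> \<noteq> 0"
  proof
    assume "\<kappa> = 0"
    then have "\<alpha> \<noteq> 0" by (auto simp: \<kappa>_def)
    with T(1) z0 \<open>\<kappa> = 0\<close> show False by simp
  qed
  moreover have "L 2 (L (- 2) (L 2 v)) \<noteq> 0" using killed_up_eq_0 w n z0 by blast
  ultimately have "\<alpha> \<noteq> 0" using T(2) by auto
  then have "(- \<kappa>) *s L 2 v = \<alpha> *s L 2 v" using T \<open>\<kappa> \<noteq> 0\<close> by simp
  then have "- \<kappa> = \<alpha>" using w0 by (simp only: scale_cancel_right simp_thms)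
  then show ?thesis by (simp add: \<kappa>_def complex_eq_iff)
qed

end

section \<open>Next to a finite-dimensional weight space of weight zero\<close>

context w22_mixed
begin

lemma weight_minus_one:
  assumes "v \<in> M (- 1)"
  shows "L 0 v = v" "L 0 (L n v) = (of_int (1 - n)) *s L n v"
proof -
  show v: "L 0 v = v" using assms by (simp add: M_def)
  show "L 0 (L n v) = (of_int (1 - n)) *s L n v"
    using LL[of 0 n v] v by (simp add: scale_left_diff_distrib)
qed

text \<open>In the Laurent model with \<open>v = t^(-1)\<close> the vector \<open>u\<close> is zero.
  Here it is shown to be singular as far as \<open>L\<close> is concerned; \<open>G 1\<close>,
  \<open>I 1\<close> and \<open>H 1\<close> are treated in
  \<open>core_killed_by_GIH\<close>.\<close>

lemma sl2_difference:
  assumes v: "v \<in> M (- 1)" "L 1 v = 0" "L (- 1) (L 2 v) = 0" "L (- 2) (L 2 v) = - v"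
  defines "u \<equiv> L (- 1) (L (- 1) v) - 2 *s L (- 2) v"
  shows "u \<in> M (- 3)" "L 1 u = 0" "L 2 u = 0"
proof -
  have "L (- 1) (L (- 1) v) \<in> M (- 3)"
    using \<rho>_M[OF \<rho>_M[OF v(1), of "Lg (- 1)"], of "Lg (- 1)"] by simp
  moreover have "L (- 2) v \<in> M (- 3)" using \<rho>_M[OF v(1), of "Lg (- 2)"] by simp
  ultimately show "u \<in> M (- 3)"
    unfolding u_def by (intro subspace_diff subspace_scale subspace_M)
  have y1: "L 1 (L (- 1) v) = 2 *s v"
    using LL[of 1 "- 1" v] v weight_minus_one(1) by simp
  have y2: "L 2 (L (- 1) v) = 0" using LL[of 2 "- 1" v] v by simp
  have "L 1 (L (- 1) (L (- 1) v)) = 6 *s L (- 1) v"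
    using LL[of 1 "- 1" "L (- 1) v"] y1 weight_minus_one(2)[OF v(1), of "- 1"]
    by (simp flip: scale_left_distrib)
  moreover have "L 1 (L (- 2) v) = 3 *s L (- 1) v" using LL[of 1 "- 2" v] v by simp
  ultimately show "L 1 u = 0" by (simp add: u_def)
  have "L 2 (L (- 1) (L (- 1) v)) = 6 *s v"
    using LL[of 2 "- 1" "L (- 1) v"] y1 y2 by simp
  \<comment> \<open>The value \<open>- v\<close> of the pairing turns \<open>4 *s v\<close> into
    \<open>3 *s v\<close>, twice which cancels \<open>6 *s v\<close>.\<close>
  moreover have "L 2 (L (- 2) v) = 4 *s v - v"
    using LL[of 2 "- 2" v] v weight_minus_one(1)[OF v(1)] by simp
  moreover have "4 *s v - v = 3 *s v"
    using scale_left_diff_distrib[of 4 1 v] by simp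
  ultimately show "L 2 u = 0" by (simp add: u_def)
qed

text \<open>
  The vector \<open>u\<close> vanishes in the Laurent model; here \<open>K\<^sub>2 u\<close> is a multiple of \<open>K\<^sub>0 v\<close>, while
  \<open>L\<^sub>1\<close> carries it to \<open>K\<^sub>3 u = 0\<close> and then \<open>K\<^sub>4 u = 0\<close>, so \<open>L\<^sub>2 K\<^sub>2 u = 0\<close>.
\<close>

lemma odd_zero_mode:
  assumes LK: "\<And>m n v. L m (\<rho> (K n) v) =
      \<rho> (K n) (L m v) + (of_int m / 2 - of_int n) *s \<rho> (K (m + n)) v"
    and v: "v \<in> M (- 1)" "L 1 v = 0" "L (- 1) (L 2 v) = 0" "L (- 2) (L 2 v) = - v"
    and K: "\<rho> (K 1) v = 0" "\<rho> (K 0) v \<in> M (- 1)"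
  shows "L 2 (\<rho> (K 0) v) = 0"
proof -
  define u where "u = L (- 1) (L (- 1) v) - 2 *s L (- 2) v"
  have u: "L 1 u = 0" "L 2 u = 0" using sl2_difference[OF v] by (simp_all add: u_def)
  have K0: "\<rho> (K 1) (L (- 1) v) = (3 / 2) *s \<rho> (K 0) v"
    using LK[of "- 1" 1 v] K by simp
  have K1: "\<rho> (K 0) (L (- 1) v) = L (- 1) (\<rho> (K 0) v) + (1 / 2) *s \<rho> (K (- 1)) v"
    using LK[of "- 1" 0 v] by simp
  have "\<rho> (K 1) (L (- 1) (L (- 1) v)) = 3 *s L (- 1) (\<rho> (K 0) v) + (3 / 4) *s \<rho> (K (- 1)) v"
    using LK[of "- 1" 1 "L (- 1) v"] K0 K1
    by (simp add: scale_right_distrib algebra_simps flip: scale_left_distrib)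
  moreover have "\<rho> (K 1) (L (- 2) v) = 2 *s \<rho> (K (- 1)) v"
    using LK[of "- 2" 1 v] K by simp
  moreover have "4 *s x = (3 / 4) *s x + (13 / 4) *s x" for x
    by (simp flip: scale_left_distrib)
  ultimately have K1u: "\<rho> (K 1) u = 3 *s L (- 1) (\<rho> (K 0) v) - (13 / 4) *s \<rho> (K (- 1)) v"
    by (simp add: u_def)
  have K0v: "L 1 (\<rho> (K 0) v) = 0" using LK[of 1 0 v] v K by simp
  have "L 1 (L (- 1) (\<rho> (K 0) v)) = 2 *s \<rho> (K 0) v"
    using LL[of 1 "- 1" "\<rho> (K 0) v"] K0v weight_minus_one(1)[OF K(2)] by simp
  moreover have "L 1 (\<rho> (K (- 1)) v) = (3 / 2) *s \<rho> (K 0) v"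
    using LK[of 1 "- 1" v] v by simp
  ultimately have "L 1 (\<rho> (K 1) u) = (9 / 8) *s \<rho> (K 0) v"
    by (simp add: K1u flip: scale_left_diff_distrib)
  then have "(- 1 / 2) *s \<rho> (K 2) u = (- 1 / 2) *s ((- 9 / 4) *s \<rho> (K 0) v)"
    using LK[of 1 1 u] u by simp
  then have K2u: "\<rho> (K 2) u = (- 9 / 4) *s \<rho> (K 0) v"
    by (simp only: scale_cancel_left) simp
  then have K3u: "\<rho> (K 3) u = 0" using LK[of 1 2 u] u K0v by simp
  then have "\<rho> (K 4) u = 0" using LK[of 1 3 u] u by simp
  then have "L 2 (\<rho> (K 2) u) = 0" using LK[of 2 2 u] u by simp
  then show ?thesis by (simp add: K2u)
qed

definition core :: "'m \<Rightarrow> bool" where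
  "core v \<longleftrightarrow> killed_up v \<and> killed_down (L 2 v) \<and> L (- 2) (L 2 v) = - v"

lemma gen_core: "fd (M 0) \<Longrightarrow> gen (- 1) core"
  unfolding core_def using gen_L2_pairing[of "- 1"]
  by (intro gen_conj gen_killed_up gen_\<rho>[where Q = killed_down] gen_killed_down) auto

text \<open>The zero modes of \<open>G\<close> and \<open>H\<close> vanish by
  \<open>odd_zero_mode\<close>, so \<open>G (- 1) v\<close> and \<open>H (- 1) v\<close> are
  singular, and then so is the vector of \<open>sl2_difference\<close>. Its vanishing yields the
  \<open>G n v\<close> with \<open>n < - 1\<close>; brackets with \<open>G 0\<close> give
  \<open>I\<close> and \<open>H\<close>.\<close>

lemma core_killed_by_GIH:
  assumes v: "v \<in> M (- 1)" "core v" and n0: "killed_up (G 0 v)" "killed_up (H 0 v)"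
  shows "G n v = 0 \<and> I n v = 0 \<and> H n v = 0"
proof -
  define w where "w = L 2 v"
  have v1: "L 1 v = 0" "G 1 v = 0" "I 1 v = 0" "H 1 v = 0"
    using v by (simp_all add: core_def killed_up_def)
  have w1: "L (- 1) w = 0" "G (- 1) w = 0" "I (- 1) w = 0" "H (- 1) w = 0"
    using v by (simp_all add: core_def killed_down_def w_def)
  have hyps: "L 1 v = 0" "L (- 1) (L 2 v) = 0" "L (- 2) (L 2 v) = - v"
    using v v1 w1 by (simp_all add: core_def w_def)
  have m0: "G 0 v \<in> M (- 1)" "H 0 v \<in> M (- 1)"
    using \<rho>_M[OF v(1), of "Gg 0"] \<rho>_M[OF v(1), of "Hg 0"] by simp_all
  have G0: "G 0 v = 0"
    using odd_zero_mode[of Gg, OF LG v(1) hyps v1(2) m0(1)] killed_up_eq_0[OF m0(1) n0(1)] by blast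
  have H0: "H 0 v = 0"
    using odd_zero_mode[of Hg, OF LH v(1) hyps v1(4) m0(2)] killed_up_eq_0[OF m0(2) n0(2)] by blast
  have I0: "I 0 v = 0" using GG[of 0 0 v] G0 by simp
  have G_1: "G (- 1) v = 0"
  proof (rule no_singular)
    show "G (- 1) v \<in> M (- 2)" using \<rho>_M[OF v(1), of "Gg (- 1)"] by simp
    show "L 1 (G (- 1) v) = 0" using LG[of 1 "- 1" v] v1 G0 by simp
    show "L 2 (G (- 1) v) = 0" using LG[of 2 "- 1" v] v1 w1 by (simp add: w_def)
    show "G 1 (G (- 1) v) = 0" using GG[of 1 "- 1" v] v1 I0 by simp
    show "I 1 (G (- 1) v) = 0" using IG[of 1 "- 1" v] v1 H0 by simp
    show "H 1 (G (- 1) v) = 0" using GH[of "- 1" 1 v] v1 by simp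
  qed
  have H_1: "H (- 1) v = 0"
  proof (rule no_singular)
    show "H (- 1) v \<in> M (- 2)" using \<rho>_M[OF v(1), of "Hg (- 1)"] by simp
    show "L 1 (H (- 1) v) = 0" using LH[of 1 "- 1" v] v1 H0 by simp
    show "L 2 (H (- 1) v) = 0" using LH[of 2 "- 1" v] v1 w1 by (simp add: w_def)
    show "G 1 (H (- 1) v) = 0" using GH[of 1 "- 1" v] v1 by simp
    show "I 1 (H (- 1) v) = 0" using IH[of 1 "- 1" v] v1 by simp
    show "H 1 (H (- 1) v) = 0" using HH[of 1 "- 1" v] v1 by simp
  qed
  have I_1: "I (- 1) v = 0" using GG[of "- 1" 0 v] G0 G_1 by simp
  define y where "y = L (- 1) v"
  have y: "G 1 y = 0" "G 0 y = 0" "H 1 y = 0" "H 0 y = 0" "I 1 y = 0" "I 0 y = 0"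
    using LG[of "- 1" 1 v] LG[of "- 1" 0 v] LH[of "- 1" 1 v] LH[of "- 1" 0 v]
      LI[of "- 1" 1 v] LI[of "- 1" 0 v] v1 G0 G_1 H0 H_1 I0 I_1 by (simp_all add: y_def)
  have u: "L (- 1) y - 2 *s L (- 2) v = 0"
  proof (rule no_singular)
    show "L (- 1) y - 2 *s L (- 2) v \<in> M (- 3)" "L 1 (L (- 1) y - 2 *s L (- 2) v) = 0"
      "L 2 (L (- 1) y - 2 *s L (- 2) v) = 0"
      unfolding y_def by (rule sl2_difference[OF v(1) hyps])+
    show "G 1 (L (- 1) y - 2 *s L (- 2) v) = 0"
      using LG[of "- 1" 1 y] LG[of "- 2" 1 v] y v1 G_1 by simp
    show "I 1 (L (- 1) y - 2 *s L (- 2) v) = 0"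
      using LI[of "- 1" 1 y] LI[of "- 2" 1 v] y v1 I_1 by simp
    show "H 1 (L (- 1) y - 2 *s L (- 2) v) = 0"
      using LH[of "- 1" 1 y] LH[of "- 2" 1 v] y v1 H_1 by simp
  qed
  have up: "G (int k - 1) v = 0" for k
  proof (induction k)
    case (Suc k)
    then show ?case using LG[of 1 "int k - 1" v] v1 half_int_neq[of 1 "int k - 1"] by simp
  qed (use G_1 in simp)
  \<comment> \<open>\<open>v\<close> need not be killed by \<open>L (- 1)\<close>, so going down
    takes the second order relation \<open>u\<close>: applying \<open>G (j + 1)\<close> to it
    isolates a multiple of \<open>G (j - 1) v\<close>.\<close>
  have down: "\<forall>n\<ge>- int k - 1. G n v = 0" for k
  proof (induction k)
    case 0
    have "G n v = 0" if "- 1 \<le> n" for n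
      using up[of "nat (n + 1)"] that by simp
    then show ?case by simp
  next
    case (Suc k)
    define j where "j = - int k - 1"
    have j: "G n v = 0" if "j \<le> n" for n using Suc that by (simp add: j_def)
    have 1: "G (j + 1) y = 0"
      using LG[of "- 1" "j + 1" v] j[of "j + 1"] j[of j] by (simp add: y_def)
    have 2: "G j y = (of_int j + 1 / 2) *s G (j - 1) v"
      using LG[of "- 1" j v] j[of j] by (simp add: y_def algebra_simps)
    define d where "d = of_int j + (3 / 2 :: complex)"
    have "of_int (- 1) / 2 - of_int (j + 1) = - d" by (simp add: d_def)
    then have "G (j + 1) (L (- 1) y) = d *s G j y"
      using LG[of "- 1" "j + 1" y] 1 by simp
    then have 3: "G (j + 1) (L (- 1) y) = ((of_int j + 3 / 2) * (of_int j + 1 / 2)) *s G (j - 1) v"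
      by (simp only: 2 scale_scale d_def)
    have 4: "G (j + 1) (L (- 2) v) = (of_int j + 2) *s G (j - 1) v"
      using LG[of "- 2" "j + 1" v] j[of "j + 1"] by (simp add: algebra_simps)
    have "L (- 1) y = 2 *s L (- 2) v" using u by simp
    with 3 4 have "((of_int j + 3 / 2) * (of_int j + 1 / 2) - 2 * (of_int j + 2)) *s G (j - 1) v = 0"
      by (auto simp: scale_left_diff_distrib)
    \<comment> \<open>The coefficient is \<open>j * j - 13 / 4\<close>, and 4 does not divide
      13.\<close>
    moreover have "(of_int j + 3 / 2) * (of_int j + 1 / 2) - 2 * (of_int j + 2) \<noteq> (0 :: complex)"
    proof
      assume "(of_int j + 3 / 2) * (of_int j + 1 / 2) - 2 * (of_int j + 2) = (0 :: complex)"
      then have "of_int (4 * (j * j)) = (of_int 13 :: complex)" by (simp add: field_simps)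
      then have "4 * (j * j) = 13" unfolding of_int_eq_iff .
      then show False by presburger
    qed
    ultimately have "G (j - 1) v = 0" by simp
    then show ?case using j by (auto simp: j_def) (smt (verit))
  qed
  have G: "G n v = 0" for n using down[of "nat \<bar>n\<bar>"] by simp
  have I: "I n v = 0" for n using GG[of n 0 v] G by simp
  have "H n v = 0"
    using IG[of n 0 v] G I H0 by (cases "n = 0") simp_all
  with G I show ?thesis by blast
qed

text \<open>The \<open>G n\<close>, \<open>I n\<close> and \<open>H n\<close> span an ideal, so the
  vectors killed by all of them form a submodule; it contains \<open>v\<close>.\<close>

lemma only_L_acts:
  assumes "v \<noteq> 0" "\<And>n. G n v = 0 \<and> I n v = 0 \<and> H n v = 0"
  shows "G n x = 0 \<and> I n x = 0 \<and> H n x = 0"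
proof -
  define N where "N = {x. \<forall>n. G n x = 0 \<and> I n x = 0 \<and> H n x = 0}"
  have "\<rho> a x \<in> N" if "x \<in> N" for a x
  proof (cases a)
    case (Lg m)
    have "G n (L m x) = 0 \<and> I n (L m x) = 0 \<and> H n (L m x) = 0" for n
      using LG[of m n x] LI[of m n x] LH[of m n x] that by (simp add: N_def)
    then show ?thesis using Lg by (simp add: N_def)
  qed (use that in \<open>simp_all add: N_def\<close>)
  moreover have "P x \<in> N" if "x \<in> N" for x
    using that P_\<rho>[of "Gg _" x] P_\<rho>[of "Ig _" x] P_\<rho>[of "Hg _" x] by (simp add: N_def)
  moreover have "subspace N" by (simp add: subspace_def N_def)
  ultimately have "N = UNIV" using irreducible[of N] assms by (auto simp: N_def)
  then show ?thesis by (auto simp: N_def)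
qed

end

section \<open>Modules on which only the Witt algebra acts\<close>

text \<open>
  The model is \<open>L\<^sub>m t\<^sup>j = - j t\<^sup>m\<^sup>+\<^sup>j\<close> on the Laurent polynomials modulo constants, with
  \<open>v = t\<^sup>-\<^sup>1\<close> and \<open>L\<^sub>n v = t\<^sup>n\<^sup>-\<^sup>1\<close>.
\<close>

context w22_mixed
begin

text \<open>In the model the claims read \<open>L (- 1) t^(n - 1) = (1 - n) t^(n - 2)\<close> and
  \<open>L n t = - t^(n + 1)\<close>. Below zero they are proved jointly, since descending in either
  takes the other.\<close>

lemma witt_orbit:
  assumes R: "\<And>n x. G n x = 0 \<and> I n x = 0 \<and> H n x = 0"
    and v: "v \<in> M (- 1)" "L 1 v = 0" "L (- 1) (L 2 v) = 0" "L (- 2) (L 2 v) = - v"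
  shows "L (- 1) (L n v) = of_int (1 - n) *s L (n - 1) v"
    and "n < 0 \<Longrightarrow> L n (L 2 v) = - L (n + 2) v"
proof -
  define S where "S n \<longleftrightarrow> L (- 1) (L n v) = of_int (1 - n) *s L (n - 1) v" for n
  define W where "W n \<longleftrightarrow> L n (L 2 v) = - L (n + 2) v" for n
  have L0: "L 0 v = v" "L 0 (L n v) = of_int (1 - n) *s L n v" for n
    using weight_minus_one[OF v(1)] by simp_all
  have L1: "L 1 (L n v) = of_int (1 - n) *s L (n + 1) v" for n
    using LL[of 1 n v] v by (simp add: add.commute)
  have pos: "S (int k + 1)" for k
  proof (induction k)
    case 0
    then show ?case using v by (simp add: S_def)
  next
    case (Suc k)
    show ?case
    proof (cases "k = 0")
      case True
      then show ?thesis using v by (simp add: S_def)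
    next
      case False
      define j where "j = int k + 1"
      have "of_int (1 - j) *s L (- 1) (L (j + 1) v) =
          L 1 (L (- 1) (L j v)) - 2 *s L 0 (L j v)"
        using LL[of "- 1" 1 "L j v"] by (simp add: L1)
      also have "L (- 1) (L j v) = of_int (1 - j) *s L (j - 1) v"
        using Suc by (simp add: S_def j_def)
      also have "L 1 (of_int (1 - j) *s L (j - 1) v) - 2 *s L 0 (L j v) =
          (of_int (1 - j) * of_int (2 - j) - 2 * of_int (1 - j)) *s L j v"
        by (simp only: \<rho>_simps L1 L0 scale_scale scale_left_diff_distrib) simp
      also have "\<dots> = of_int (1 - j) *s (of_int (- j) *s L j v)"
        by (simp add: algebra_simps)
      finally have "L (- 1) (L (j + 1) v) = of_int (- j) *s L j v"
        using False by (simp only: scale_cancel_left of_int_eq_0_iff j_def) simp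
      then show ?thesis by (simp add: S_def j_def add_ac)
    qed
  qed
  have S0: "S 0" by (simp add: S_def L0)
  have W1: "W (- 1)" using v by (simp add: W_def)
  have neg: "S (- int k) \<and> W (- int k - 1)" for k
  proof (induction k rule: less_induct)
    case (less k)
    define j where "j = - int k - 1"
    have S': "S i" if "j + 1 < i" for i
    proof (cases "0 < i")
      case True
      then show ?thesis using pos[of "nat (i - 1)"] by simp
    next
      case False
      then show ?thesis using less[of "nat (- i)"] that by (simp add: j_def)
    qed
    have shift: "1 - (j + 2) = - j - 1" "j + 2 - 1 = j + 1" "1 - (j + 3) = - j - 2" "j + 3 - 1 = j + 2"
      by simp_all
    have W': "W i" if "j < i" "i < 0" for i
      using less[of "nat (- i - 1)"] that by (simp add: j_def)
    \<comment> \<open>The recursion needs \<open>j + 1\<close> negative and \<open>- j - 2\<close>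
      nonzero, so \<open>j = - 1\<close> and \<open>j = - 2\<close> are settled by the
      hypotheses.\<close>
    consider "k = 0" | "k = 1" | "2 \<le> k" by linarith
    then have W: "W j"
    proof cases
      case 1
      then show ?thesis using W1 by (simp add: j_def)
    next
      case 2
      then show ?thesis using v L0 by (simp add: j_def W_def)
    next
      case 3
      have "of_int (- j - 2) *s L j (L 2 v) = L (- 1) (L (j + 1) (L 2 v)) - L (j + 1) (L (- 1) (L 2 v))"
        using LL[of "- 1" "j + 1" "L 2 v"] by simp
      also have "\<dots> = - L (- 1) (L (j + 3) v)"
        using W'[of "j + 1"] 3 v by (simp add: W_def j_def)
      also have "L (- 1) (L (j + 3) v) = of_int (- j - 2) *s L (j + 2) v"
        using S'[of "j + 3"] unfolding S_def by (simp only: shift)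
      also have "- (of_int (- j - 2) *s L (j + 2) v) = of_int (- j - 2) *s (- L (j + 2) v)"
        by (simp only: scale_minus_right)
      finally have "L j (L 2 v) = - L (j + 2) v"
        using 3 by (simp only: scale_cancel_left of_int_eq_0_iff j_def) simp
      then show ?thesis by (simp add: W_def)
    qed
    moreover have "S (j + 1)"
    proof (cases "k = 0")
      case True
      then show ?thesis using S0 by (simp add: j_def)
    next
      case False
      \<comment> \<open>The defect of \<open>S (j + 1)\<close>. Once \<open>L 1\<close> and
        \<open>L 2\<close> kill it, it is singular, because \<open>G\<close>, \<open>I\<close> and
        \<open>H\<close> act by zero.\<close>
      define d where "d = L (- 1) (L (j + 1) v) + of_int j *s L j v"
      have L2: "L 2 (L i v) = of_int (1 - i) *s L (i + 2) v" if "W i" for i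
        using LL[of 2 i v] that by (simp add: W_def scale_left_diff_distrib scale_two add.commute)
      have 1: "L (- 1) (L (j + 2) v) = of_int (- j - 1) *s L (j + 1) v"
        using S'[of "j + 2"] unfolding S_def by (simp only: shift)
      have 2: "L (- 1) (L (j + 3) v) = of_int (- j - 2) *s L (j + 2) v"
        using S'[of "j + 3"] unfolding S_def by (simp only: shift)
      have 3: "L 1 (L (j + 1) v) = of_int (- j) *s L (j + 2) v"
        "L 0 (L (j + 1) v) = of_int (- j) *s L (j + 1) v"
        using L1[of "j + 1"] L0(2)[of "j + 1"] by (simp_all add: add.commute)
      have "L 1 (L (- 1) (L (j + 1) v)) = L (- 1) (L 1 (L (j + 1) v)) + 2 *s L 0 (L (j + 1) v)"
        using LL[of 1 "- 1" "L (j + 1) v"] by simp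
      also have "\<dots> = (of_int (- j) * of_int (- j - 1) + 2 * of_int (- j)) *s L (j + 1) v"
        by (simp only: 1 3 \<rho>_simps scale_scale scale_left_distrib)
      finally have "L 1 d = (of_int (- j) * of_int (- j - 1) + 2 * of_int (- j) +
          of_int j * of_int (1 - j)) *s L (j + 1) v"
        by (simp only: d_def \<rho>_simps L1 scale_scale scale_left_distrib)
      then have d1: "L 1 d = 0" by (simp add: algebra_simps)
      have W2: "W (j + 1)" using W'[of "j + 1"] False by (simp add: j_def)
      have 4: "L 2 (L (j + 1) v) = of_int (- j) *s L (j + 3) v" using L2[OF W2] by (simp add: add.commute)
      have "L 2 (L (- 1) (L (j + 1) v)) = L (- 1) (L 2 (L (j + 1) v)) + 3 *s L 1 (L (j + 1) v)"
        using LL[of 2 "- 1" "L (j + 1) v"] by simp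
      also have "\<dots> = (of_int (- j) * of_int (- j - 2) + 3 * of_int (- j)) *s L (j + 2) v"
        by (simp only: 2 3 4 \<rho>_simps scale_scale scale_left_distrib)
      finally have "L 2 d = (of_int (- j) * of_int (- j - 2) + 3 * of_int (- j) +
          of_int j * of_int (1 - j)) *s L (j + 2) v"
        by (simp only: d_def \<rho>_simps L2[OF W] scale_scale scale_left_distrib)
      then have d2: "L 2 d = 0" by (simp add: algebra_simps)
      have "d \<in> M (of_int (j - 1))"
        using \<rho>_M[OF \<rho>_M[OF v(1), of "Lg (j + 1)"], of "Lg (- 1)"] \<rho>_M[OF v(1), of "Lg j"]
        unfolding d_def by (intro subspace_add subspace_scale subspace_M) (simp_all add: algebra_simps)
      then have "d = 0" by (rule no_singular) (simp_all add: d1 d2 R)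
      then show ?thesis by (simp add: S_def d_def eq_neg_iff_add_eq_0)
    qed
    ultimately show ?case by (simp add: j_def)
  qed
  show "L (- 1) (L n v) = of_int (1 - n) *s L (n - 1) v"
  proof (cases "0 < n")
    case True
    then show ?thesis using pos[of "nat (n - 1)"] by (simp add: S_def)
  next
    case False
    then show ?thesis using neg[of "nat (- n)"] by (simp add: S_def)
  qed
  show "L n (L 2 v) = - L (n + 2) v" if "n < 0"
    using neg[of "nat (- n - 1)"] that by (simp add: W_def)
qed

lemma witt_orbit_closed:
  assumes R: "\<And>n x. G n x = 0 \<and> I n x = 0 \<and> H n x = 0"
    and v: "v \<in> M (- 1)" "L 1 v = 0" "L (- 1) (L 2 v) = 0" "L (- 2) (L 2 v) = - v"
    and m: "m \<in> {- 2, - 1, 1, 2}"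
  shows "L m (L n v) = of_int (1 - n) *s L (m + n) v"
proof -
  have 1: "L 1 (L n v) = of_int (1 - n) *s L (n + 1) v"
    using LL[of 1 n v] v by (simp add: add.commute)
  \<comment> \<open>Reversing the grading exchanges \<open>v\<close> and \<open>L 2 v\<close>, in
    the model \<open>t^(-1)\<close> and \<open>t\<close>. The mirrored \<open>witt_orbit\<close>
    thus supplies the modes on \<open>L 2 v\<close> that are not negative.\<close>
  have "w22_rep.M scale \<rho>' (- 1) = M 1" by (simp add: mirror_M)
  moreover have "L 2 v \<in> M 1" using \<rho>_M[OF v(1), of "Lg 2"] by simp
  ultimately have "n < 0 \<Longrightarrow> \<rho>' (Lg n) (\<rho>' (Lg 2) (L 2 v)) = - \<rho>' (Lg (n + 2)) (L 2 v)" for n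
    using v R by (intro w22_mixed.witt_orbit(2)[OF mirror]) (simp_all add: \<rho>'_def)
  from this[of "- n" for n] have pos: "0 < n \<Longrightarrow> L (n - 2) (L 2 v) = - L n v" for n
    using v by (simp add: \<rho>'_def)
  have W: "L n (L 2 v) = - L (n + 2) v" for n
    using witt_orbit(2)[OF R v, of n] pos[of "n + 2"] by (cases "n < 0") auto
  have 2: "L 2 (L n v) = of_int (1 - n) *s L (2 + n) v"
    using LL[of 2 n v] W[of n] by (simp add: scale_left_diff_distrib scale_two add.commute)
  \<comment> \<open>As \<open>L n v = - L (n - 2) (L 2 v)\<close>, the letter \<open>L (- 2)\<close>
    can be moved onto \<open>L 2 v\<close>, where it gives \<open>- v\<close>.\<close>
  have "L (- 2) (L (n - 2) (L 2 v)) = L (n - 2) (L (- 2) (L 2 v)) + of_int (- n) *s L (n - 4) (L 2 v)"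
    using LL[of "- 2" "n - 2" "L 2 v"] by simp
  then have "- L (- 2) (L n v) = - (of_int (1 - n) *s L (n - 2) v)"
    using W[of "n - 2"] W[of "n - 4"] v by (simp add: scale_left_diff_distrib)
  then have "L (- 2) (L n v) = of_int (1 - n) *s L (n - 2) v"
    by (simp only: neg_equal_iff_equal)
  with 1 2 witt_orbit(1)[OF R v, of n] m show ?thesis by (auto simp: add.commute)
qed

text \<open>The \<open>L n v\<close> and \<open>L n (P v)\<close> span a submodule with weight
  spaces of dimension at most two, against \<open>inf\<close>. \<open>P v\<close> is included since
  \<open>v\<close> need not be homogeneous.\<close>

lemma no_witt_vector:
  assumes R: "\<And>n x. G n x = 0 \<and> I n x = 0 \<and> H n x = 0"
    and v: "v \<in> M (- 1)" "L 1 v = 0" "L (- 1) (L 2 v) = 0" "L (- 2) (L 2 v) = - v"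
    and "v \<noteq> 0" and inf: "\<not> fd (M (- 1))"
  shows False
proof -
  define S where "S \<alpha> = span (\<Union>n\<in>{n. \<alpha> = of_int n - 1}. {L n v, L n (P v)})" for \<alpha> :: complex
  define A where "A = range (\<lambda>n. of_int n - 1 :: complex)"
  define N where "N = span (\<Union>n. {L n v, L n (P v)})"
  have S: "S (of_int n - 1) = span {L n v, L n (P v)}" for n
    by (simp add: S_def)
  have PL: "L n (P x) = P (L n x)" for n x using P_\<rho>[of "Lg n" x] by simp
  have vP: "P v \<in> M (- 1)" "L 1 (P v) = 0" "L (- 1) (L 2 (P v)) = 0" "L (- 2) (L 2 (P v)) = - P v"
    using v P_M by (simp_all add: PL)
  have base: "L n v \<in> N" "L n (P v) \<in> N" for n
    unfolding N_def by (auto intro: span_base)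
  have sub: "subspace N" unfolding N_def by simp
  \<comment> \<open>Modes preserving \<open>N\<close>. They are closed under sums of distinct modes,
    so \<open>- 2\<close>, \<open>- 1\<close>, \<open>1\<close> and \<open>2\<close> produce all
    integers.\<close>
  define B where "B = {m. \<forall>x\<in>N. L m x \<in> N}"
  have gen: "m \<in> B" if "\<And>n. L m (L n v) \<in> N" "\<And>n. L m (L n (P v)) \<in> N" for m
  proof -
    have "L m x \<in> N" if "x \<in> span (\<Union>n. {L n v, L n (P v)})" for x
      using that \<open>\<And>n. L m (L n v) \<in> N\<close> \<open>\<And>n. L m (L n (P v)) \<in> N\<close> sub
      by (induction rule: span_induct_alt) (auto intro: subspace_add subspace_scale subspace_0)
    then show ?thesis by (simp add: B_def N_def)
  qed
  have small: "m \<in> B" if "m \<in> {- 2, - 1, 1, 2}" for m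
    using witt_orbit_closed[OF R v that] witt_orbit_closed[OF R vP that] base sub
    by (intro gen) (auto intro: subspace_scale)
  have add: "m + n \<in> B" if "m \<in> B" "n \<in> B" "m \<noteq> n" for m n
  proof -
    have "L (m + n) x \<in> N" if "x \<in> N" for x
    proof -
      have "L m (L n x) - L n (L m x) \<in> N"
        using \<open>m \<in> B\<close> \<open>n \<in> B\<close> that sub by (auto simp: B_def intro: subspace_diff)
      then have "(1 / of_int (m - n)) *s (L m (L n x) - L n (L m x)) \<in> N"
        using sub subspace_scale by blast
      then show ?thesis using LL[of m n x] \<open>m \<noteq> n\<close> by simp
    qed
    then show ?thesis by (simp add: B_def)
  qed
  have "int k + 1 \<in> B" for k
  proof (induction k)
    case (Suc k)
    then show ?case using add[of "int k + 1" 1] small by (cases "k = 0") (auto simp: add_ac)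
  qed (use small in simp)
  moreover have "- int k - 1 \<in> B" for k
  proof (induction k)
    case (Suc k)
    then show ?case using add[of "- int k - 1" "- 1"] small by (cases "k = 0") (auto simp: algebra_simps)
  qed (use small in simp)
  moreover have "0 \<in> B" using add[of 1 "- 1"] small by simp
  moreover have "\<exists>k. m = int k + 1 \<or> m = - int k - 1 \<or> m = 0" for m
    by presburger
  ultimately have "m \<in> B" for m by metis
  then have "\<rho> a x \<in> N" if "x \<in> N" for a x
    using R that subspace_0[OF sub] by (cases a) (auto simp: B_def)
  moreover have "P x \<in> N" if "x \<in> N" for x
    using that base sub unfolding N_def
    by (induction rule: span_induct_alt)
      (auto simp flip: PL simp: P_P intro!: span_add span_scale intro: span_zero)
  moreover have "v \<in> N" using base(1)[of 0] weight_minus_one[OF v(1)] by simp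
  ultimately have "N = UNIV" using irreducible[OF sub] \<open>v \<noteq> 0\<close> by blast
  moreover have "N \<subseteq> span (\<Union>\<alpha>\<in>A. S \<alpha>)"
    unfolding N_def A_def by (intro span_mono) (auto simp: S intro: span_base)
  ultimately have span: "span (\<Union>\<alpha>\<in>A. S \<alpha>) = UNIV" by blast
  have SM: "S \<alpha> \<subseteq> M \<alpha>" if "\<alpha> \<in> A" for \<alpha>
  proof -
    from that obtain n where n: "\<alpha> = of_int n - 1" by (auto simp: A_def)
    have "{L n v, L n (P v)} \<subseteq> M \<alpha>"
      using \<rho>_M[OF v(1), of "Lg n"] \<rho>_M[OF vP(1), of "Lg n"] by (simp add: n)
    then show ?thesis unfolding n S using span_minimal subspace_M by blast
  qed
  have subS: "subspace (S \<alpha>)" for \<alpha> by (simp add: S_def)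
  have "x \<in> S (- 1)" if "x \<in> M (- 1)" for x
  proof (cases "x = 0")
    case True
    then show ?thesis by (simp add: subS subspace_0)
  next
    case False
    then show ?thesis using spanning_weight_family[OF span subS SM that] by blast
  qed
  then have "M (- 1) \<subseteq> span {L 0 v, L 0 (P v)}" using S[of 0] by auto
  moreover have "finite {L 0 v, L 0 (P v)}" by simp
  ultimately show False using inf unfolding fd_def by blast
qed

section \<open>Finite dimension spreads to all weight spaces\<close>

lemma adjacent_weight_False:
  assumes inf: "\<not> fd (M \<alpha>)" and fd: "fd (M (\<alpha> + 1))"
  shows False
proof -
  have \<alpha>: "\<alpha> = - 1" by (rule adjacent_weight) fact+
  have "gen (- 1) (\<lambda>v. core v \<and> killed_up (G 0 v) \<and> killed_up (H 0 v))"
    using fd by (intro gen_conj gen_core gen_\<rho>[where Q = killed_up] gen_killed_up) (auto simp: \<alpha>)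
  then obtain v where v: "v \<in> M (- 1)" "v \<noteq> 0" "core v" "killed_up (G 0 v)" "killed_up (H 0 v)"
    using gen_exists inf unfolding \<alpha> by blast
  have "G n x = 0 \<and> I n x = 0 \<and> H n x = 0" for n x
    by (rule only_L_acts[OF v(2)]) (rule core_killed_by_GIH[OF v(1,3-)])
  then show False
    by (rule no_witt_vector[of v]) (use v inf \<alpha> in \<open>auto simp: core_def killed_up_def killed_down_def\<close>)
qed

text \<open>Irreducibility confines the weights to one class modulo the integers. Along it finite
  dimension passes down by \<open>adjacent_weight_False\<close> and up by its mirror image.\<close>

lemma inconsistent: False
proof -
  obtain \<mu> x where \<mu>: "fd (M \<mu>)" "x \<in> M \<mu>" "x \<noteq> 0"
    using fd_weight subspace_0[OF subspace_M] by blast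
  obtain \<alpha> where \<alpha>: "\<not> fd (M \<alpha>)" using not_fd_weight by blast
  define A where "A = range (\<lambda>n. \<mu> + of_int n)"
  define N where "N = span (\<Union>\<alpha>\<in>A. M \<alpha>)"
  have A: "\<alpha> + of_int n \<in> A" if "\<alpha> \<in> A" for \<alpha> n
  proof -
    from that obtain m where "\<alpha> = \<mu> + of_int m" by (auto simp: A_def)
    then have "\<alpha> + of_int n = \<mu> + of_int (m + n)" by simp
    then show ?thesis unfolding A_def by blast
  qed
  have "\<rho> a y \<in> N" if "y \<in> N" for a y
    using that unfolding N_def
  proof (induction rule: span_induct_alt)
    case (step c y z)
    then have "\<rho> a y \<in> span (\<Union>\<alpha>\<in>A. M \<alpha>)" using \<rho>_M A by (auto intro!: span_base) blast
    with step show ?case by (auto intro: span_add span_scale)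
  qed (auto intro: span_zero)
  moreover have "P y \<in> N" if "y \<in> N" for y
    using that unfolding N_def
  proof (induction rule: span_induct_alt)
    case (step c y z)
    then have "P y \<in> span (\<Union>\<alpha>\<in>A. M \<alpha>)" using P_M by (auto intro: span_base)
    with step show ?case by (auto intro: span_add span_scale)
  qed (auto intro: span_zero)
  moreover have "x \<in> N" unfolding N_def A_def using \<mu> by (auto intro!: span_base exI[of _ 0])
  ultimately have span: "span (\<Union>\<alpha>\<in>A. M \<alpha>) = UNIV"
    using irreducible[of N] \<mu> by (auto simp: N_def)
  obtain y where "y \<in> M \<alpha>" "y \<noteq> 0" using \<alpha> fd_zero fd_subset[of "{0}" "M \<alpha>"] by blast
  then have "\<alpha> \<in> A" using spanning_weight_family[OF span] subspace_M by blast
  then obtain m where m: "\<alpha> = \<mu> + of_int m" by (auto simp: A_def)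
  have up: "fd (M (\<mu> + of_int (n + 1)))" if "fd (M (\<mu> + of_int n))" for n
  proof (rule ccontr)
    assume "\<not> fd (M (\<mu> + of_int (n + 1)))"
    then have "\<not> fd (w22_rep.M scale \<rho>' (- (\<mu> + of_int (n + 1))))"
      "fd (w22_rep.M scale \<rho>' (- (\<mu> + of_int (n + 1)) + 1))"
      using that by (simp_all add: mirror_M algebra_simps)
    then show False by (rule w22_mixed.adjacent_weight_False[OF mirror])
  qed
  have down: "fd (M (\<mu> + of_int (n - 1)))" if "fd (M (\<mu> + of_int n))" for n
    using adjacent_weight_False[of "\<mu> + of_int (n - 1)"] that by (auto simp: algebra_simps)
  have "fd (M (\<mu> + of_int n))" for n
    by (induction n rule: int_induct[of _ 0]) (use \<mu> up down in auto)
  then show False using \<alpha> m by blast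
qed

end

section \<open>Modules over the super \<open>W(2,2)\<close> algebra\<close>

context super_vector_space
begin

text \<open>The operator form of the grading that \<open>w22_rep\<close> takes. The components are
  only assumed to exist; their uniqueness comes from \<open>hom_disjoint\<close>.\<close>

definition parity_involution :: "'v \<Rightarrow> 'v" where
  "parity_involution v = (THE p. \<exists>a\<in>hom 0. \<exists>b\<in>hom 1. v = a + b \<and> p = a - b)"

lemma parity_involution_eq:
  assumes "a \<in> hom 0" "b \<in> hom 1"
  shows "parity_involution (a + b) = a - b"
  unfolding parity_involution_def
proof (rule the_equality)
  fix p assume "\<exists>a'\<in>hom 0. \<exists>b'\<in>hom 1. a + b = a' + b' \<and> p = a' - b'"
  then obtain a' b' where *: "a' \<in> hom 0" "b' \<in> hom 1" "a + b = a' + b'" "p = a' - b'" by blast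
  then have "a - a' = b' - b" by (simp add: algebra_simps)
  moreover have "a - a' \<in> hom 0" "b' - b \<in> hom 1"
    using assms * subspace_hom by (auto intro: subspace_diff)
  ultimately have "a - a' \<in> hom 0 \<inter> hom 1" by simp
  with \<open>a - a' = b' - b\<close> have "a = a'" "b = b'" by (auto simp: hom_disjoint)
  with * show "p = a - b" by simp
qed (use assms in blast)

lemma linear_parity_involution: "Vector_Spaces.linear scale scale parity_involution"
proof unfold_locales
  fix v w c
  obtain a b where v: "a \<in> hom 0" "b \<in> hom 1" "v = a + b" using hom_spans by blast
  obtain a' b' where w: "a' \<in> hom 0" "b' \<in> hom 1" "w = a' + b'" using hom_spans by blast
  have "v + w = (a + a') + (b + b')" using v w by simp
  then have "parity_involution (v + w) = (a + a') - (b + b')"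
    using v w subspace_hom by (simp only:) (rule parity_involution_eq; auto intro: subspace_add)
  then show "parity_involution (v + w) = parity_involution v + parity_involution w"
    using v w by (simp add: parity_involution_eq)
  have "parity_involution (scale c a + scale c b) = scale c a - scale c b"
    using v subspace_hom by (intro parity_involution_eq) (auto intro: subspace_scale)
  then show "parity_involution (scale c v) = scale c (parity_involution v)"
    using v by (simp add: parity_involution_eq scale_right_distrib scale_right_diff_distrib)
qed

lemma parity_involution_involution: "parity_involution (parity_involution v) = v"
proof -
  obtain a b where v: "a \<in> hom 0" "b \<in> hom 1" "v = a + b" using hom_spans by blast
  moreover have "- b \<in> hom 1" using v subspace_hom subspace_neg by blast
  ultimately show ?thesis using parity_involution_eq[of a "- b"] by (simp add: parity_involution_eq)
qed

end

context w22_module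
begin

lemma act_scale: "act (w22_scale c x) v = scale c (act x v)"
  using linear_act_left[of v, THEN Vector_Spaces.linear.axioms(3)] by (rule module_hom.scale)

lemma act_add: "act (x + y) v = act x v + act y v"
  using linear_act_left[of v, THEN Vector_Spaces.linear.axioms(3)] by (rule module_hom.add)

lemma act_zero: "act 0 v = 0"
  using linear_act_left[of v, THEN Vector_Spaces.linear.axioms(3)] by (rule module_hom.zero)

lemma act_single: "act (Poly_Mapping.single a c) v = scale c (act (basis a) v)"
  using act_scale[of c "basis a" v] by simp

lemma basis_hom: "basis a \<in> w22_hom (gen_parity a)"
  by (simp add: w22_hom_def)

lemma act_basis_commute:
  "act (basis a) (act (basis b) v) =
    scale (super_sign (gen_parity a) (gen_parity b)) (act (basis b) (act (basis a) v)) +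
    act (gen_bracket a b) v"
  using act_bracket[OF basis_hom basis_hom, of a b v] by (simp add: w22_bracket_basis)

lemma parity_involution_act:
  "V.parity_involution (act (basis a) v) =
    (if gen_parity a = 0 then act (basis a) (V.parity_involution v)
     else - act (basis a) (V.parity_involution v))"
proof -
  interpret act: Vector_Spaces.linear scale scale "act (basis a)" by (rule linear_act_right)
  obtain x y where v: "x \<in> hom 0" "y \<in> hom 1" "v = x + y" using V.hom_spans by blast
  have xy: "act (basis a) x \<in> hom (gen_parity a + 0)" "act (basis a) y \<in> hom (gen_parity a + 1)"
    using act_hom[OF basis_hom] v by blast+
  show ?thesis
  proof (cases "gen_parity a = 0")
    case True
    then show ?thesis
      using xy v by (simp add: act.add act.diff V.parity_involution_eq)
  next
    case False
    then have "gen_parity a = 1" by simp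
    then show ?thesis
      using xy v V.parity_involution_eq[of "act (basis a) y" "act (basis a) x"]
      by (simp add: act.add act.diff V.parity_involution_eq add.commute)
  qed
qed

lemma w22_rep:
  assumes "irreducible_module"
  shows "w22_rep scale (\<lambda>a. act (basis a)) V.parity_involution"
proof (rule w22_rep.intro)
  show "vector_space scale" by (rule V.vector_space_axioms)
  let ?\<rho> = "\<lambda>a. act (basis a)"
  have rel:
    "?\<rho> (Lg m) (?\<rho> (Lg n) v) =
      ?\<rho> (Lg n) (?\<rho> (Lg m) v) + scale (of_int (m - n)) (?\<rho> (Lg (m + n)) v)"
    "?\<rho> (Lg m) (?\<rho> (Ig n) v) =
      ?\<rho> (Ig n) (?\<rho> (Lg m) v) + scale (of_int (m - n)) (?\<rho> (Ig (m + n)) v)"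
    "?\<rho> (Lg m) (?\<rho> (Gg n) v) =
      ?\<rho> (Gg n) (?\<rho> (Lg m) v) + scale (of_int m / 2 - of_int n) (?\<rho> (Gg (m + n)) v)"
    "?\<rho> (Lg m) (?\<rho> (Hg n) v) =
      ?\<rho> (Hg n) (?\<rho> (Lg m) v) + scale (of_int m / 2 - of_int n) (?\<rho> (Hg (m + n)) v)"
    "?\<rho> (Gg m) (?\<rho> (Gg n) v) = - ?\<rho> (Gg n) (?\<rho> (Gg m) v) + ?\<rho> (Ig (m + n)) v"
    "?\<rho> (Ig m) (?\<rho> (Gg n) v) =
      ?\<rho> (Gg n) (?\<rho> (Ig m) v) + scale (of_int (m - 2 * n)) (?\<rho> (Hg (m + n)) v)"
    "?\<rho> (Ig m) (?\<rho> (Ig n) v) = ?\<rho> (Ig n) (?\<rho> (Ig m) v)"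
    "?\<rho> (Ig m) (?\<rho> (Hg n) v) = ?\<rho> (Hg n) (?\<rho> (Ig m) v)"
    "?\<rho> (Gg m) (?\<rho> (Hg n) v) = - ?\<rho> (Hg n) (?\<rho> (Gg m) v)"
    "?\<rho> (Hg m) (?\<rho> (Hg n) v) = - ?\<rho> (Hg n) (?\<rho> (Hg m) v)" for m n v
    by (subst act_basis_commute, simp add: super_sign_def act_zero act_single[of _ "_ - _"])+
  have irr: "N = {0} \<or> N = UNIV"
    if N: "V.subspace N" "\<And>a v. v \<in> N \<Longrightarrow> act (basis a) v \<in> N" "\<And>v. v \<in> N \<Longrightarrow> V.parity_involution v \<in> N" for N
  proof -
    have hom: "act x v \<in> N" if "x \<in> w22_hom i" "v \<in> N" for x v i
      using that(1)
      by (induction rule: w22_hom_induct)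
        (use N that(2) in \<open>auto simp: act_add act_scale act_zero intro: V.subspace_0 V.subspace_add V.subspace_scale\<close>)
    have "act x v \<in> N" if "v \<in> N" for x v
    proof -
      obtain y z where "y \<in> w22_hom 0" "z \<in> w22_hom 1" "x = y + z" using w22.hom_spans by blast
      then show ?thesis using hom that N(1) by (auto simp: act_add intro: V.subspace_add)
    qed
    moreover have "\<exists>a\<in>N \<inter> hom 0. \<exists>b\<in>N \<inter> hom 1. v = a + b" if "v \<in> N" for v
    proof -
      obtain a b where v: "a \<in> hom 0" "b \<in> hom 1" "v = a + b" using V.hom_spans by blast
      have p: "V.parity_involution v = a - b" using v by (simp add: V.parity_involution_eq)
      have two: "x + x = scale 2 x" for x
        by (metis one_add_one V.scale_left_distrib V.scale_one)
      \<comment> \<open>Halving these recovers the homogeneous components of \<open>v\<close>, so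
        stability under the involution makes \<open>N\<close> graded.\<close>
      have "v + V.parity_involution v = scale 2 a" "v - V.parity_involution v = scale 2 b"
        unfolding p using v(3) two[of a] two[of b] by simp_all
      moreover have "scale (1 / 2) (v + V.parity_involution v) \<in> N"
        by (intro V.subspace_scale V.subspace_add N that)
      moreover have "scale (1 / 2) (v - V.parity_involution v) \<in> N"
        by (intro V.subspace_scale V.subspace_diff N that)
      ultimately have "a \<in> N" "b \<in> N" by simp_all
      then show ?thesis using v by blast
    qed
    ultimately have "submodule N" using N(1) by (auto simp: submodule_def)
    then show ?thesis using assms by (auto simp: irreducible_module_def)
  qed
  show "w22_rep_axioms scale (\<lambda>a. act (basis a)) V.parity_involution"
    by (rule w22_rep_axioms.intro)
      (fact rel linear_act_right V.linear_parity_involution parity_involution_act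
        V.parity_involution_involution irr)+
qed

text \<open>This reconciles \<open>finite_dim\<close> with \<open>fd\<close>: a maximal independent
  subset of \<open>S\<close> inside a finitely spanned space is finite and spans exactly
  \<open>S\<close>.\<close>

lemma finite_dim_iff:
  assumes "V.subspace S"
  shows "finite_dim S \<longleftrightarrow> (\<exists>B. finite B \<and> S \<subseteq> V.span B)"
proof
  assume "\<exists>B. finite B \<and> S \<subseteq> V.span B"
  then obtain B where B: "finite B" "S \<subseteq> V.span B" by blast
  obtain D where D: "D \<subseteq> S" "V.independent D" "S \<subseteq> V.span D"
    using V.maximal_independent_subset by blast
  have "finite D" using V.independent_span_bound[OF B(1) D(2)] D(1) B(2) by auto
  moreover have "V.span D = S" using D assms V.span_minimal by blast
  ultimately show "finite_dim S" by (auto simp: finite_dim_def)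
qed (auto simp: finite_dim_def)

lemma not_mixed:
  assumes "irreducible_module"
  shows "\<not> mixed"
proof
  assume "mixed"
  then obtain \<alpha> \<beta> where *: "\<beta> \<in> Supp" "\<not> finite_dim (weight_space \<alpha>)" "finite_dim (weight_space \<beta>)"
    by (auto simp: mixed_def)
  interpret R: w22_rep scale "\<lambda>a. act (basis a)" V.parity_involution
    by (rule w22_rep) fact
  have M: "weight_space \<alpha> = R.M \<alpha>" for \<alpha>
    by (simp add: weight_space_def R.M_def)
  have fd: "finite_dim (weight_space \<alpha>) \<longleftrightarrow> R.fd (R.M \<alpha>)" for \<alpha>
    unfolding M R.fd_def by (rule finite_dim_iff) (rule R.subspace_M)
  have "w22_mixed scale (\<lambda>a. act (basis a)) V.parity_involution"
  proof (intro w22_mixed.intro w22_mixed_axioms.intro)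
    show "\<exists>\<mu>. R.M \<mu> \<noteq> {0} \<and> R.fd (R.M \<mu>)"
      using *(1,3) unfolding Supp_def fd by (auto simp: M)
    show "\<exists>\<alpha>. \<not> R.fd (R.M \<alpha>)" using *(2) unfolding fd by blast
  qed (rule R.w22_rep_axioms)
  then show False by (rule w22_mixed.inconsistent)
qed

end

theorem corollary2p3:
  fixes scale :: "complex \<Rightarrow> 'm::ab_group_add \<Rightarrow> 'm"
    and hom :: "bit \<Rightarrow> 'm set"
    and act :: "w22 \<Rightarrow> 'm \<Rightarrow> 'm"
  assumes "w22_module scale hom act"
    and "w22_module.weight_module scale act"
    and "lie_supermodule.irreducible_module scale hom act"
  shows "\<not> w22_module.mixed scale act"
  using assms(1,3) by (rule w22_module.not_mixed)

end
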